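(* Let $G$ be a finitely generated group acting by isometries on a quasitree $Q$. Let $x_0\in Q$ and let $r>0$ be such that the Rips orbit graph $\Gamma_r(x_0)$ is connected and, with its path metric, admits a coarse $G$-equivariant quasi-isometric embedding into $Q$ (for every $x_0$ such an $r$ exists). Then $\Gamma_r(x_0)$ is quasi-isometric to a simplicial tree $T$. If $G\cdot x_0$ is a locally finite orbit then $T$ can be taken to have bounded valence.
   Context: A quasitree is a geodesic metric space that is quasi-isometric to a simplicial tree. For $G$ acting by isometries on a metric space $(X,d_X)$, $x_0\in X$ and $r\ge 0$, the Rips orbit graph $\Gamma_r(x_0)$ is the graph with vertex set the orbit $G\cdot x_0$ and an edge between distinct vertices $v,w$ if and only if $d_X(v,w)\le r$; $G$ acts on it by graph automorphisms. The orbit $G\cdot x_0$ is locally finite if for all $R\ge 0$ the set of points $\{g(x_0): g\in G,\ d_X(g(x_0),x_0)\le R\}$ is finite. If $G$ acts by isometries on metric spaces $Y$ and $X$, a map $F:Y\to X$ is coarse $G$-equivariant if there is $M\ge 0$ with $d_X(F(g(y)),g(F(y)))\le M$ for all $y\in Y$, $g\in G$. *)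

theory Defs
  imports "HOL-Analysis.Analysis" "HOL-Algebra.Group_Action" "HOL-Algebra.Generated_Groups"
begin

section \<open>Metric spaces, quasi-isometries and isometric actions\<close>

definition geodesic_metric_space :: "'a set \<Rightarrow> ('a \<Rightarrow> 'a \<Rightarrow> real) \<Rightarrow> bool" where
  "geodesic_metric_space X d \<longleftrightarrow> Metric_space X d \<and>
     (\<forall>x\<in>X. \<forall>y\<in>X. \<exists>\<gamma>. \<gamma> ` {0..d x y} \<subseteq> X \<and> \<gamma> 0 = x \<and> \<gamma> (d x y) = y \<and>
        (\<forall>s\<in>{0..d x y}. \<forall>t\<in>{0..d x y}. d (\<gamma> s) (\<gamma> t) = \<bar>s - t\<bar>))"

definition qi_embedding ::
  "'a set \<Rightarrow> ('a \<Rightarrow> 'a \<Rightarrow> real) \<Rightarrow> 'b set \<Rightarrow> ('b \<Rightarrow> 'b \<Rightarrow> real) \<Rightarrow> ('a \<Rightarrow> 'b) \<Rightarrow> bool" where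
  "qi_embedding X dX Y dY F \<longleftrightarrow> F ` X \<subseteq> Y \<and>
     (\<exists>K\<ge>1. \<exists>c\<ge>0. \<forall>x\<in>X. \<forall>x'\<in>X.
        dX x x' / K - c \<le> dY (F x) (F x') \<and> dY (F x) (F x') \<le> K * dX x x' + c)"

definition quasi_isometry ::
  "'a set \<Rightarrow> ('a \<Rightarrow> 'a \<Rightarrow> real) \<Rightarrow> 'b set \<Rightarrow> ('b \<Rightarrow> 'b \<Rightarrow> real) \<Rightarrow> ('a \<Rightarrow> 'b) \<Rightarrow> bool" where
  "quasi_isometry X dX Y dY F \<longleftrightarrow> qi_embedding X dX Y dY F \<and>
     (\<exists>C\<ge>0. \<forall>y\<in>Y. \<exists>x\<in>X. dY (F x) y \<le> C)"

definition quasi_isometric ::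
  "'a set \<Rightarrow> ('a \<Rightarrow> 'a \<Rightarrow> real) \<Rightarrow> 'b set \<Rightarrow> ('b \<Rightarrow> 'b \<Rightarrow> real) \<Rightarrow> bool" where
  "quasi_isometric X dX Y dY \<longleftrightarrow> (\<exists>F. quasi_isometry X dX Y dY F)"

definition finitely_generated :: "('g, 'm) monoid_scheme \<Rightarrow> bool" where
  "finitely_generated G \<longleftrightarrow> (\<exists>S. finite S \<and> S \<subseteq> carrier G \<and> generate G S = carrier G)"

definition isometric_action ::
  "('g, 'm) monoid_scheme \<Rightarrow> ('g \<Rightarrow> 'a \<Rightarrow> 'a) \<Rightarrow> 'a set \<Rightarrow> ('a \<Rightarrow> 'a \<Rightarrow> real) \<Rightarrow> bool" where
  "isometric_action G \<phi> X d \<longleftrightarrow> group_action G X \<phi> \<and>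
     (\<forall>g\<in>carrier G. \<forall>x\<in>X. \<forall>y\<in>X. d (\<phi> g x) (\<phi> g y) = d x y)"

definition coarse_equivariant ::
  "('g, 'm) monoid_scheme \<Rightarrow> 'a set \<Rightarrow> ('g \<Rightarrow> 'a \<Rightarrow> 'a) \<Rightarrow>
     ('b \<Rightarrow> 'b \<Rightarrow> real) \<Rightarrow> ('g \<Rightarrow> 'b \<Rightarrow> 'b) \<Rightarrow> ('a \<Rightarrow> 'b) \<Rightarrow> bool" where
  "coarse_equivariant G Y \<psi> dX \<phi> F \<longleftrightarrow>
     (\<exists>M\<ge>0. \<forall>y\<in>Y. \<forall>g\<in>carrier G. dX (F (\<psi> g y)) (\<phi> g (F y)) \<le> M)"

definition locally_finite_orbit ::
  "('g, 'm) monoid_scheme \<Rightarrow> ('g \<Rightarrow> 'a \<Rightarrow> 'a) \<Rightarrow> ('a \<Rightarrow> 'a \<Rightarrow> real) \<Rightarrow> 'a \<Rightarrow> bool" where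
  "locally_finite_orbit G \<phi> d x0 \<longleftrightarrow> (\<forall>R\<ge>0. finite {y \<in> orbit G \<phi> x0. d y x0 \<le> R})"


section \<open>Graphs and simplicial trees\<close>

text \<open>A simple graph, of arbitrary cardinality, is given by its vertex set and its set of
  edges, which are two-element sets of vertices.\<close>

definition simple_graph :: "'v set \<Rightarrow> 'v set set \<Rightarrow> bool" where
  "simple_graph V E \<longleftrightarrow> E \<subseteq> {{u, v} | u v. u \<in> V \<and> v \<in> V \<and> u \<noteq> v}"

definition graph_walk :: "'v set \<Rightarrow> 'v set set \<Rightarrow> 'v list \<Rightarrow> bool" where
  "graph_walk V E xs \<longleftrightarrow>
     xs \<noteq> [] \<and> set xs \<subseteq> V \<and> successively (\<lambda>u v. {u, v} \<in> E) xs"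

definition graph_connected :: "'v set \<Rightarrow> 'v set set \<Rightarrow> bool" where
  "graph_connected V E \<longleftrightarrow> V \<noteq> {} \<and>
     (\<forall>u\<in>V. \<forall>v\<in>V. \<exists>xs. graph_walk V E xs \<and> hd xs = u \<and> last xs = v)"

definition graph_cycle :: "'v set \<Rightarrow> 'v set set \<Rightarrow> 'v list \<Rightarrow> bool" where
  "graph_cycle V E xs \<longleftrightarrow>
     graph_walk V E xs \<and> distinct xs \<and> 3 \<le> length xs \<and> {last xs, hd xs} \<in> E"

definition simplicial_tree :: "'v set \<Rightarrow> 'v set set \<Rightarrow> bool" where
  "simplicial_tree V E \<longleftrightarrow>
     simple_graph V E \<and> graph_connected V E \<and> (\<nexists>xs. graph_cycle V E xs)"

definition bounded_valence :: "'v set \<Rightarrow> 'v set set \<Rightarrow> bool" where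
  "bounded_valence V E \<longleftrightarrow>
     (\<exists>k::nat. \<forall>v\<in>V. finite {w. {v, w} \<in> E} \<and> card {w. {v, w} \<in> E} \<le> k)"

text \<open>The number of edges on a shortest walk; only meaningful in a connected graph.\<close>

definition graph_dist :: "'v set \<Rightarrow> 'v set set \<Rightarrow> 'v \<Rightarrow> 'v \<Rightarrow> nat" where
  "graph_dist V E u v =
     (LEAST n. \<exists>xs. graph_walk V E xs \<and> hd xs = u \<and> last xs = v \<and> length xs = Suc n)"


section \<open>A connected graph as a metric space\<close>

text \<open>The points of the geometric realization are given by barycentric coordinates: the point
  at distance t from v on the edge joining v and w is the function taking the
  values 1 - t at v, t at w and 0 elsewhere.\<close>

definition coord_supp :: "('v \<Rightarrow> real) \<Rightarrow> 'v set" where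
  "coord_supp p = {v. p v \<noteq> 0}"

definition realization :: "'v set \<Rightarrow> 'v set set \<Rightarrow> ('v \<Rightarrow> real) set" where
  "realization V E =
     {p. (\<forall>v. 0 \<le> p v) \<and> (coord_supp p \<in> E \<or> (\<exists>v\<in>V. coord_supp p = {v})) \<and>
         (\<Sum>v\<in>coord_supp p. p v) = 1}"

text \<open>The path metric for which every edge is isometric to the unit interval. Two points on a
  common edge are joined by the segment between them; otherwise a shortest path first runs
  from p to an end point u of its edge, at distance 1 - p u, then along a shortest
  edge path to an end point v of the edge of q, and from there to q.\<close>

definition realization_dist ::
  "'v set \<Rightarrow> 'v set set \<Rightarrow> ('v \<Rightarrow> real) \<Rightarrow> ('v \<Rightarrow> real) \<Rightarrow> real" where
  "realization_dist V E p q =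
     (if \<exists>e\<in>E. coord_supp p \<union> coord_supp q \<subseteq> e
      then (\<Sum>v\<in>coord_supp p \<union> coord_supp q. \<bar>p v - q v\<bar>) / 2
      else Min {(1 - p u) + real (graph_dist V E u v) + (1 - q v) | u v.
                  u \<in> coord_supp p \<and> v \<in> coord_supp q})"

text \<open>The action on the realization induced by an action on the vertex set.\<close>

definition realization_action ::
  "('g, 'm) monoid_scheme \<Rightarrow> ('g \<Rightarrow> 'v \<Rightarrow> 'v) \<Rightarrow> 'v set \<Rightarrow> 'g \<Rightarrow> ('v \<Rightarrow> real) \<Rightarrow> ('v \<Rightarrow> real)" where
  "realization_action G \<phi> V g p = (\<lambda>v. if v \<in> V then p (\<phi> (inv\<^bsub>G\<^esub> g) v) else 0)"


section \<open>Quasitrees and Rips orbit graphs\<close>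

text \<open>The type argument is the type of the vertices of the tree. Statements assuming that a
  space is a quasitree are to be polymorphic in it.\<close>

definition quasitree :: "'t itself \<Rightarrow> 'a set \<Rightarrow> ('a \<Rightarrow> 'a \<Rightarrow> real) \<Rightarrow> bool" where
  "quasitree vertex_type X d \<longleftrightarrow> geodesic_metric_space X d \<and>
     (\<exists>(V :: 't set) E. simplicial_tree V E \<and>
        quasi_isometric X d (realization V E) (realization_dist V E))"

definition rips_edges :: "'a set \<Rightarrow> ('a \<Rightarrow> 'a \<Rightarrow> real) \<Rightarrow> real \<Rightarrow> 'a set set" where
  "rips_edges V d r = {{v, w} | v w. v \<in> V \<and> w \<in> V \<and> v \<noteq> w \<and> d v w \<le> r}"

abbreviation rips_orbit_edges ::
  "('g, 'm) monoid_scheme \<Rightarrow> ('g \<Rightarrow> 'a \<Rightarrow> 'a) \<Rightarrow> ('a \<Rightarrow> 'a \<Rightarrow> real) \<Rightarrow> 'a \<Rightarrow> real \<Rightarrow> 'a set set" where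
  "rips_orbit_edges G \<phi> d x0 r \<equiv> rips_edges (orbit G \<phi> x0) d r"

definition rips_space ::
  "('g, 'm) monoid_scheme \<Rightarrow> ('g \<Rightarrow> 'a \<Rightarrow> 'a) \<Rightarrow> ('a \<Rightarrow> 'a \<Rightarrow> real) \<Rightarrow> 'a \<Rightarrow> real \<Rightarrow>
     ('a \<Rightarrow> real) set" where
  "rips_space G \<phi> d x0 r = realization (orbit G \<phi> x0) (rips_orbit_edges G \<phi> d x0 r)"

definition rips_dist ::
  "('g, 'm) monoid_scheme \<Rightarrow> ('g \<Rightarrow> 'a \<Rightarrow> 'a) \<Rightarrow> ('a \<Rightarrow> 'a \<Rightarrow> real) \<Rightarrow> 'a \<Rightarrow> real \<Rightarrow>
     ('a \<Rightarrow> real) \<Rightarrow> ('a \<Rightarrow> real) \<Rightarrow> real" where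
  "rips_dist G \<phi> d x0 r = realization_dist (orbit G \<phi> x0) (rips_orbit_edges G \<phi> d x0 r)"

definition admissible_rips_graph ::
  "('g, 'm) monoid_scheme \<Rightarrow> ('g \<Rightarrow> 'a \<Rightarrow> 'a) \<Rightarrow> 'a set \<Rightarrow> ('a \<Rightarrow> 'a \<Rightarrow> real) \<Rightarrow> 'a \<Rightarrow> real \<Rightarrow> bool"
  where
  "admissible_rips_graph G \<phi> Q d x0 r \<longleftrightarrow>
     graph_connected (orbit G \<phi> x0) (rips_orbit_edges G \<phi> d x0 r) \<and>
     (\<exists>F. qi_embedding (rips_space G \<phi> d x0 r) (rips_dist G \<phi> d x0 r) Q d F \<and>
          coarse_equivariant G (rips_space G \<phi> d x0 r)
            (realization_action G \<phi> (orbit G \<phi> x0)) d \<phi> F)"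

end

theory Submission
  imports Defs "HOL-Library.Transitive_Closure_Table"
begin

text \<open>In a tree, every interior vertex of a geodesic separates its end points, so a chain of points
  with bounded jumps passes close to every vertex of the geodesic joining its ends.

  The orbit of a finitely generated group is such a chain, and so is its image in the tree T
  approximating Q. Following a geodesic of T by orbit points bounds the distance in the Rips graph
  linearly in the distance of Q once r is large. Conversely, a Rips graph that embeds in Q
  embeds in T, and its image is coarsely dense in its convex hull, which is a countable subtree. At a
  vertex v of the hull, every branch contains a point of the image close to v, and distinct
  branches give distinct points; hence the hull has bounded valence as soon as the orbit is locally
  finite.\<close>

section \<open>Graph distance and intervals\<close>

text \<open>T may have vertices of infinite valence and a vertex set of any cardinality in any type,
  whereas the target is a tree on the natural numbers. The hull deals with both problems: branches
  of T that carry no point of the image are cut off, and since the orbit of a finitely generated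
  group is countable, what remains is a countable union of countable intervals and can be numbered.
  The image of the orbit is discrete and may miss every vertex of a geodesic, so connectedness is
  replaced throughout by chains with jumps of length at most L. The combinatorial estimates are made
  on vertex sets with the integer distance; passing to and from realizations costs a bounded
  additive error.\<close>

definition adj :: "'v set set \<Rightarrow> ('v \<times> 'v) set" where
  "adj E = {(u, v). {u, v} \<in> E}"

text \<open>Its reflexive transitive closure describes the components left after deleting
  \<open>w\<close>; the closure also relates \<open>w\<close> to itself, but to no other
  vertex.\<close>

definition avoid :: "'v set set \<Rightarrow> 'v \<Rightarrow> ('v \<times> 'v) set" where
  "avoid E w = {(u, v). {u, v} \<in> E \<and> u \<noteq> w \<and> v \<noteq> w}"

lemma sym_adj: "sym (adj E)"
  by (auto simp: adj_def sym_def insert_commute)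

lemma sym_avoid: "sym (avoid E w)"
  by (auto simp: avoid_def sym_def insert_commute)

lemma avoid_sym: "(u, v) \<in> (avoid E w)\<^sup>* \<Longrightarrow> (v, u) \<in> (avoid E w)\<^sup>*"
  using sym_avoid sym_rtrancl by (metis symD)

lemma avoid_neq: "(u, v) \<in> (avoid E w)\<^sup>* \<Longrightarrow> u \<noteq> w \<Longrightarrow> v \<noteq> w"
  by (induction rule: rtrancl_induct) (auto simp: avoid_def)

lemma simple_graph_edge:
  assumes "simple_graph V E" "{u, v} \<in> E"
  shows "u \<in> V" "v \<in> V" "u \<noteq> v"
  using assms unfolding simple_graph_def by (auto simp: doubleton_eq_iff)

lemma graph_walk_Cons:
  "graph_walk V E (x # xs) \<longleftrightarrow>
     x \<in> V \<and> (xs = [] \<or> graph_walk V E xs \<and> {x, hd xs} \<in> E)"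
  by (cases xs) (auto simp: graph_walk_def)

text \<open>Relational powers concatenate, split and reverse more easily than vertex lists; the
  shift by one is that between counting vertices and counting edges.\<close>

lemma walk_iff_relpow:
  assumes "simple_graph V E" "u \<in> V"
  shows "(\<exists>xs. graph_walk V E xs \<and> hd xs = u \<and> last xs = v \<and> length xs = Suc n)
    \<longleftrightarrow> (u, v) \<in> adj E ^^ n"
  using assms(2)
proof (induction n arbitrary: u)
  case 0
  then show ?case
    by (auto simp: length_Suc_conv graph_walk_def intro!: exI[of _ "[u]"])
next
  case (Suc n)
  have "(\<exists>xs. graph_walk V E xs \<and> hd xs = u \<and> last xs = v \<and> length xs = Suc (Suc n))
    \<longleftrightarrow> (\<exists>w ys. {u, w} \<in> E \<and> graph_walk V E ys \<and> hd ys = w \<and> last ys = v \<and> length ys = Suc n)"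
    (is "?L \<longleftrightarrow> ?R")
  proof
    assume ?L
    then obtain xs where xs: "graph_walk V E xs" "hd xs = u" "last xs = v" "length xs = Suc (Suc n)"
      by blast
    then obtain ys where "xs = u # ys" "length ys = Suc n"
      by (auto simp: length_Suc_conv)
    with xs show ?R
      by (intro exI[of _ "hd ys"] exI[of _ ys]) (auto simp: graph_walk_Cons split: if_splits)
  next
    assume ?R
    then obtain ys where "{u, hd ys} \<in> E" "graph_walk V E ys" "last ys = v" "length ys = Suc n"
      by blast
    with Suc.prems show ?L
      by (intro exI[of _ "u # ys"]) (auto simp: graph_walk_Cons)
  qed
  also have "\<dots> \<longleftrightarrow> (\<exists>w. (u, w) \<in> adj E \<and> (w, v) \<in> adj E ^^ n)"
    using Suc.IH simple_graph_edge[OF assms(1)] unfolding adj_def by blast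
  also have "\<dots> \<longleftrightarrow> (u, v) \<in> adj E ^^ Suc n"
    by (meson relpow_Suc_D2 relpow_Suc_I2)
  finally show ?case .
qed

locale connected_graph =
  fixes V :: "'v set" and E :: "'v set set"
  assumes simple: "simple_graph V E" and connected: "graph_connected V E"
begin

abbreviation gd :: "'v \<Rightarrow> 'v \<Rightarrow> nat" where
  "gd \<equiv> graph_dist V E"

lemmas edge = simple_graph_edge[OF simple]

lemma gd_eq: "u \<in> V \<Longrightarrow> gd u v = (LEAST n. (u, v) \<in> adj E ^^ n)"
  by (simp add: graph_dist_def walk_iff_relpow[OF simple])

lemma gd_le: "u \<in> V \<Longrightarrow> (u, v) \<in> adj E ^^ n \<Longrightarrow> gd u v \<le> n"
  by (simp add: gd_eq Least_le)

lemma gd_walk: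
  assumes "u \<in> V" "v \<in> V"
  shows "(u, v) \<in> adj E ^^ gd u v"
proof -
  obtain xs where xs: "graph_walk V E xs" "hd xs = u" "last xs = v"
    using connected assms unfolding graph_connected_def by blast
  then have "length xs = Suc (length xs - 1)"
    by (auto simp: graph_walk_def)
  with xs have "(u, v) \<in> adj E ^^ (length xs - 1)"
    using walk_iff_relpow[OF simple assms(1)] by blast
  then show ?thesis
    using LeastI[of "\<lambda>n. (u, v) \<in> adj E ^^ n"] by (simp add: gd_eq[OF assms(1)])
qed

lemma gd_self [simp]: "u \<in> V \<Longrightarrow> gd u u = 0"
  using gd_le[of u u 0] by simp

lemma gd_eq_0_iff: "u \<in> V \<Longrightarrow> v \<in> V \<Longrightarrow> gd u v = 0 \<longleftrightarrow> u = v"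
  using gd_walk[of u v] by auto

lemma gd_triangle: "u \<in> V \<Longrightarrow> v \<in> V \<Longrightarrow> w \<in> V \<Longrightarrow> gd u w \<le> gd u v + gd v w"
  using gd_walk[of u v] gd_walk[of v w] by (auto simp: relpow_add intro!: gd_le)

lemma gd_sym:
  assumes "u \<in> V" "v \<in> V"
  shows "gd u v = gd v u"
proof -
  have "gd v u \<le> gd u v" if "u \<in> V" "v \<in> V" for u v
  proof (rule gd_le[OF that(2)])
    have "sym (adj E ^^ n)" for n :: nat
    proof (induction n)
      case (Suc n)
      show ?case
      proof (rule symI)
        fix a b assume "(a, b) \<in> adj E ^^ Suc n"
        then obtain c where "(a, c) \<in> adj E ^^ n" "(c, b) \<in> adj E"
          by auto
        then show "(b, a) \<in> adj E ^^ Suc n"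
          using Suc sym_adj by (meson relpow_Suc_I2 symD)
      qed
    qed (auto simp: sym_def)
    then show "(v, u) \<in> adj E ^^ gd u v"
      using gd_walk[OF that] by (meson symD)
  qed
  with assms show ?thesis
    by (meson antisym)
qed

lemma gd_edge:
  assumes "{u, v} \<in> E"
  shows "gd u v = 1"
proof -
  have "gd u v \<le> 1"
    using assms edge[OF assms] by (intro gd_le) (auto simp: adj_def)
  moreover have "gd u v \<noteq> 0"
    using edge[OF assms] gd_eq_0_iff by blast
  ultimately show ?thesis by linarith
qed

definition interval :: "'v \<Rightarrow> 'v \<Rightarrow> 'v set" where
  "interval u v = {w \<in> V. gd u w + gd w v = gd u v}"

lemma interval_ends: "u \<in> V \<Longrightarrow> v \<in> V \<Longrightarrow> u \<in> interval u v \<and> v \<in> interval u v"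
  by (simp add: interval_def)

lemma interval_trans:
  assumes "u \<in> interval t a" "w \<in> interval t u" "t \<in> V" "a \<in> V"
  shows "w \<in> interval t a"
  using assms gd_triangle[of w u a] gd_triangle[of t w a] by (auto simp: interval_def)

lemma geodesic:
  assumes "u \<in> V" "v \<in> V"
  obtains f where "f 0 = u" "f (gd u v) = v" "\<And>i. i < gd u v \<Longrightarrow> {f i, f (Suc i)} \<in> E"
    "\<And>i. i \<le> gd u v \<Longrightarrow> f i \<in> interval u v" "\<And>i. i \<le> gd u v \<Longrightarrow> gd u (f i) = i"
proof -
  define n where "n = gd u v"
  obtain f where f: "f 0 = u" "f n = v" and step: "\<And>i. i < n \<Longrightarrow> (f i, f (Suc i)) \<in> adj E"
    using gd_walk[OF assms] unfolding n_def relpow_fun_conv by blast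
  have walk: "(f i, f (i + k)) \<in> adj E ^^ k" if "i + k \<le> n" for i k
    using that by (induction k) (auto intro!: relpow_Suc_I step)
  have inV: "f i \<in> V" if "i \<le> n" for i
    using that assms f step edge by (cases "i = n") (auto simp: adj_def le_less)
  \<comment> \<open>The two bounds add up to \<open>gd u v\<close>, so the triangle inequality
    forces equality in both.\<close>
  have "gd u (f i) \<le> i" "gd (f i) v \<le> n - i" if "i \<le> n" for i
    using walk[of 0 i] walk[of i "n - i"] that f gd_le inV[OF that] assms by auto
  then have "f i \<in> interval u v \<and> gd u (f i) = i" if "i \<le> n" for i
    using that inV[OF that] gd_triangle[of u "f i" v] assms unfolding interval_def n_def
    by fastforce
  then show thesis
    using that f step unfolding n_def adj_def by auto
qed

text \<open>A shortest walk never leaves the interval and hence misses \<open>w\<close>. The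
  converse, \<open>interval_separates\<close>, is special to trees.\<close>

lemma avoid_if_not_interval:
  assumes "u \<in> V" "v \<in> V" "w \<notin> interval u v"
  shows "(u, v) \<in> (avoid E w)\<^sup>*"
proof -
  obtain f where f: "f 0 = u" "f (gd u v) = v" "\<And>i. i < gd u v \<Longrightarrow> {f i, f (Suc i)} \<in> E"
    "\<And>i. i \<le> gd u v \<Longrightarrow> f i \<in> interval u v"
    using geodesic assms by metis
  have "(f i, f (Suc i)) \<in> avoid E w" if "i < gd u v" for i
    using that f(3)[of i] f(4)[of i] f(4)[of "Suc i"] assms(3) unfolding avoid_def by auto
  then have "(u, v) \<in> avoid E w ^^ gd u v"
    using f unfolding relpow_fun_conv by blast
  then show ?thesis by (rule relpow_imp_rtrancl)
qed

text \<open>\<open>a\<close> is the vertex just before \<open>w\<close> on a geodesic from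
  \<open>u\<close>. It is closer to \<open>u\<close> than \<open>w\<close> is, so no geodesic from
  \<open>u\<close> to \<open>a\<close> can pass through \<open>w\<close>.\<close>

lemma predecessor:
  assumes "u \<in> V" "w \<in> V" "u \<noteq> w"
  obtains a where "{w, a} \<in> E" "gd u a + 1 = gd u w" "(u, a) \<in> (avoid E w)\<^sup>*"
proof -
  obtain f where f: "f 0 = u" "f (gd u w) = w" "\<And>i. i < gd u w \<Longrightarrow> {f i, f (Suc i)} \<in> E"
    "\<And>i. i \<le> gd u w \<Longrightarrow> gd u (f i) = i"
    using geodesic[OF assms(1,2)] by metis
  obtain n where n: "gd u w = Suc n"
    using gd_eq_0_iff assms by (metis not0_implies_Suc)
  have e: "{f n, w} \<in> E" and g: "gd u (f n) = n"
    using f(2) f(3)[of n] f(4)[of n] n by auto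
  have "w \<notin> interval u (f n)"
    using n g by (auto simp: interval_def)
  then show thesis
    using that[of "f n"] e g n avoid_if_not_interval edge[OF e] assms by (auto simp: insert_commute)
qed

end


section \<open>Cut vertices in trees\<close>

locale tree = connected_graph +
  assumes acyclic: "\<nexists>xs. graph_cycle V E xs"
begin

text \<open>A path from \<open>a\<close> to \<open>b\<close> that misses \<open>v\<close> can be
  made free of repetitions and then closes up through \<open>v\<close> to a cycle. It has at least
  three vertices because \<open>a\<close> and \<open>b\<close> differ.\<close>

lemma neighbours_separated:
  assumes "{v, a} \<in> E" "{v, b} \<in> E" "a \<noteq> b"
  shows "(a, b) \<notin> (avoid E v)\<^sup>*"
proof
  assume "(a, b) \<in> (avoid E v)\<^sup>*"
  then have "(\<lambda>x y. (x, y) \<in> avoid E v)\<^sup>*\<^sup>* a b"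
    by (simp add: rtranclp_rtrancl_eq)
  then obtain xs where path: "rtrancl_path (\<lambda>x y. (x, y) \<in> avoid E v) a xs b"
    and dist: "distinct (a # xs)"
    unfolding rtranclp_eq_rtrancl_path using rtrancl_path_distinct by metis
  have "a \<in> V" using assms edge by blast
  with path have "graph_walk V E (a # xs) \<and> last (a # xs) = b \<and> v \<notin> set xs"
  proof (induction rule: rtrancl_path.induct)
    case (base x)
    then show ?case by (simp add: graph_walk_Cons)
  next
    case (step x y ys z)
    then have "{x, y} \<in> E" "y \<noteq> v"
      by (auto simp: avoid_def)
    with step show ?case
      using edge[of x y] by (auto simp: graph_walk_Cons)
  qed
  then have "graph_cycle V E (v # a # xs)"
    using assms dist edge by (cases xs) (auto simp: graph_cycle_def graph_walk_Cons insert_commute)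
  then show False using acyclic by blast
qed

text \<open>The neighbours of \<open>w\<close> towards \<open>u\<close> and towards \<open>v\<close>
  differ, since a common one would shorten the way from \<open>u\<close> to \<open>v\<close> by two.
  A connection of \<open>u\<close> and \<open>v\<close> off \<open>w\<close> would join these
  neighbours off \<open>w\<close>.\<close>

lemma interval_separates:
  assumes "u \<in> V" "v \<in> V" "w \<in> interval u v" "w \<noteq> u" "w \<noteq> v"
  shows "(u, v) \<notin> (avoid E w)\<^sup>*"
proof
  assume uv: "(u, v) \<in> (avoid E w)\<^sup>*"
  have w: "w \<in> V" "gd u w + gd w v = gd u v"
    using assms by (auto simp: interval_def)
  obtain a where a: "{w, a} \<in> E" "gd u a + 1 = gd u w" "(u, a) \<in> (avoid E w)\<^sup>*"
    using predecessor w assms by metis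
  obtain b where b: "{w, b} \<in> E" "gd v b + 1 = gd v w" "(v, b) \<in> (avoid E w)\<^sup>*"
    using predecessor w assms by metis
  have "gd u v \<le> gd u a + gd v a" "gd v w = gd w v"
    using gd_triangle gd_sym w assms edge(2)[OF a(1)] by metis+
  then have "a \<noteq> b"
    using a b w by auto
  moreover have "(a, b) \<in> (avoid E w)\<^sup>*"
    using a(3) uv b(3) avoid_sym by (meson rtrancl_trans)
  ultimately show False
    using neighbours_separated a b by blast
qed

text \<open>The distance from \<open>u\<close> numbers the interval: a second vertex at the same
  distance as \<open>w\<close> would lie on a geodesic from \<open>u\<close> to \<open>v\<close>
  that goes around \<open>w\<close>.\<close>

lemma countable_interval:
  assumes "u \<in> V" "v \<in> V"
  shows "countable (interval u v)"
proof (rule countableI')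
  show "inj_on (gd u) (interval u v)"
  proof (rule inj_onI, rule ccontr)
    fix w w' assume w: "w \<in> interval u v" and w': "w' \<in> interval u v"
      and eq: "gd u w = gd u w'" and ne: "w \<noteq> w'"
    have V: "w \<in> V" "w' \<in> V" and eq2: "gd w v = gd w' v" and pos: "gd w' w \<noteq> 0" "gd w w' \<noteq> 0"
      using w w' eq ne gd_eq_0_iff by (auto simp: interval_def)
    have "w \<notin> interval u w'" "w \<notin> interval w' v"
      using eq eq2 pos by (auto simp: interval_def)
    then have "(u, v) \<in> (avoid E w)\<^sup>*"
      using avoid_if_not_interval assms V by (meson rtrancl_trans)
    moreover have "w \<noteq> u" "w \<noteq> v"
      using eq eq2 pos ne V assms gd_eq_0_iff by metis+
    ultimately show False
      using interval_separates assms w by blast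
  qed
qed

text \<open>If \<open>w\<close> lies between \<open>a\<close> and \<open>b\<close>, then
  \<open>gd a w \<le> gd a b\<close>, so a jump over \<open>w\<close> must start within
  \<open>L\<close> of it. If no point of \<open>A\<close> is that close, geodesics between
  successive points of the chain join up to a walk around \<open>w\<close>.\<close>

lemma bottleneck:
  assumes chain: "(u, v) \<in> {(a, b). a \<in> A \<and> b \<in> A \<and> real (gd a b) \<le> L}\<^sup>*"
    and "A \<subseteq> V" "u \<in> A" "v \<in> A" "w \<in> interval u v" "L \<ge> 0"
  shows "\<exists>a\<in>A. real (gd a w) \<le> L"
proof (rule ccontr)
  assume far: "\<not> ?thesis"
  have w: "w \<in> V" using assms by (auto simp: interval_def)
  have "(u, x) \<in> (avoid E w)\<^sup>*" if "(u, x) \<in> {(a, b). a \<in> A \<and> b \<in> A \<and> real (gd a b) \<le> L}\<^sup>*" for x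
    using that
  proof (induction rule: rtrancl_induct)
    case (step a b)
    then have "w \<notin> interval a b"
      using far by (force simp: interval_def)
    then show ?case
      using step avoid_if_not_interval assms(2) by (blast intro: rtrancl_trans)
  qed auto
  moreover have "w \<noteq> u" "w \<noteq> v"
    using far assms w by force+
  ultimately show False
    using interval_separates chain assms by blast
qed

end

lemma simplicial_tree_iff: "simplicial_tree V E \<longleftrightarrow> tree V E"
  by (simp add: simplicial_tree_def tree_def connected_graph_def tree_axioms_def)


section \<open>The hull of a coarsely connected set in a tree\<close>

locale tree_hull = tree +
  fixes A :: "'a set" and t0 :: 'a and L :: real
  assumes A_sub: "A \<subseteq> V" and t0: "t0 \<in> A" and L: "L \<ge> 0"
    and chain: "\<And>a. a \<in> A \<Longrightarrow> (t0, a) \<in> {(a, b). a \<in> A \<and> b \<in> A \<and> real (gd a b) \<le> L}\<^sup>*"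
begin

text \<open>In a tree, the geodesics from one base point already fill the convex hull of
  \<open>A\<close> (see \<open>subtree_convex\<close>). With only one end varying, countability and
  nearness to \<open>A\<close> are immediate.\<close>

definition subtree :: "'a set" where
  "subtree = (\<Union>a\<in>A. interval t0 a)"

definition subtree_edges :: "'a set set" where
  "subtree_edges = {e \<in> E. e \<subseteq> subtree}"

lemma t0_V: "t0 \<in> V"
  using A_sub t0 by blast

lemma subtree_sub: "subtree \<subseteq> V"
  by (auto simp: subtree_def interval_def)

lemma A_subtree: "A \<subseteq> subtree"
  using A_sub t0_V interval_ends unfolding subtree_def by blast

lemma subtree_near: "w \<in> subtree \<Longrightarrow> \<exists>a\<in>A. real (gd a w) \<le> L"
  using bottleneck[OF chain A_sub t0 _ _ L] unfolding subtree_def by blast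

lemma countable_subtree: "countable A \<Longrightarrow> countable subtree"
  unfolding subtree_def using countable_interval t0_V A_sub by (intro countable_UN) auto

text \<open>The three points \<open>u\<close>, \<open>v\<close>, \<open>t0\<close> span a tripod: a
  vertex between \<open>u\<close> and \<open>v\<close> that lies on neither leg towards
  \<open>t0\<close> could be bypassed through \<open>t0\<close>.\<close>

lemma subtree_convex:
  assumes "u \<in> subtree" "v \<in> subtree" "w \<in> interval u v"
  shows "w \<in> subtree"
proof (cases "w = u \<or> w = v")
  case False
  have V: "u \<in> V" "v \<in> V" using assms subtree_sub by auto
  have "w \<in> interval t0 u \<or> w \<in> interval t0 v"
  proof (rule ccontr)
    assume "\<not> ?thesis"
    then have "(u, t0) \<in> (avoid E w)\<^sup>*" "(t0, v) \<in> (avoid E w)\<^sup>*"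
      using avoid_if_not_interval avoid_sym V t0_V by metis+
    then show False
      using interval_separates[OF V assms(3)] False by (meson rtrancl_trans)
  qed
  then show ?thesis
    using assms(1,2) A_sub t0_V interval_trans unfolding subtree_def by blast
qed (use assms in auto)

lemma subtree_walk:
  assumes "u \<in> subtree" "v \<in> subtree"
  shows "(u, v) \<in> adj subtree_edges ^^ gd u v"
proof -
  obtain f where f: "f 0 = u" "f (gd u v) = v" "\<And>i. i < gd u v \<Longrightarrow> {f i, f (Suc i)} \<in> E"
    "\<And>i. i \<le> gd u v \<Longrightarrow> f i \<in> interval u v"
    using geodesic assms subtree_sub by (metis subsetD)
  have "(f i, f (Suc i)) \<in> adj subtree_edges" if "i < gd u v" for i
    using that f(3)[of i] f(4)[of i] f(4)[of "Suc i"] subtree_convex[OF assms]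
    unfolding adj_def subtree_edges_def by auto
  then show ?thesis
    using f unfolding relpow_fun_conv by blast
qed

lemma subtree_simple: "simple_graph subtree subtree_edges"
proof -
  have "\<exists>u v. e = {u, v} \<and> u \<in> subtree \<and> v \<in> subtree \<and> u \<noteq> v" if "e \<in> subtree_edges" for e
  proof -
    have "e \<in> {{u, v} | u v. u \<in> V \<and> v \<in> V \<and> u \<noteq> v}" "e \<subseteq> subtree"
      using that simple by (auto simp: simple_graph_def subtree_edges_def)
    then show ?thesis by force
  qed
  then show ?thesis unfolding simple_graph_def by blast
qed

lemma tree_subtree: "tree subtree subtree_edges"
proof
  show "simple_graph subtree subtree_edges" by (rule subtree_simple)
  show "graph_connected subtree subtree_edges"
    unfolding graph_connected_def
    using t0 A_subtree subtree_walk walk_iff_relpow[OF subtree_simple] by blast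
  show "\<nexists>xs. graph_cycle subtree subtree_edges xs"
  proof
    assume "\<exists>xs. graph_cycle subtree subtree_edges xs"
    then obtain xs where "graph_cycle subtree subtree_edges xs" by blast
    then have "graph_cycle V E xs"
      using subtree_sub successively_mono[of "\<lambda>u v. {u, v} \<in> subtree_edges" xs "\<lambda>u v. {u, v} \<in> E"]
      unfolding graph_cycle_def graph_walk_def subtree_edges_def by blast
    then show False using acyclic by blast
  qed
qed

text \<open>Convexity keeps geodesics of the tree inside the hull, and removing edges cannot shorten
  any distance.\<close>

lemma subtree_dist:
  assumes "u \<in> subtree" "v \<in> subtree"
  shows "graph_dist subtree subtree_edges u v = gd u v"
proof (rule antisym)
  interpret H: tree subtree subtree_edges by (rule tree_subtree)
  show "H.gd u v \<le> gd u v"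
    using H.gd_le subtree_walk assms by blast
  have "adj subtree_edges \<subseteq> adj E"
    by (auto simp: adj_def subtree_edges_def)
  then have "adj subtree_edges ^^ n \<subseteq> adj E ^^ n" for n :: nat
    by (induction n) auto
  then show "gd u v \<le> H.gd u v"
    using H.gd_walk[OF assms] assms subtree_sub by (intro gd_le) auto
qed

text \<open>Some point of A lies on the branch of w at v and some point of A does not, so a chain
  through A has to jump over v when it leaves the branch.\<close>

lemma subtree_branch:
  assumes "v \<in> subtree" "w \<in> subtree" "{v, w} \<in> E"
  shows "\<exists>a\<in>A. (w, a) \<in> (avoid E v)\<^sup>* \<and> real (gd a v) \<le> L"
proof -
  have V: "v \<in> V" "w \<in> V" "v \<noteq> w" and vw: "gd w v = 1" "gd v w = 1"
    using edge[OF assms(3)] gd_edge[OF assms(3)] gd_sym by auto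
  obtain a where a: "a \<in> A" "w \<in> interval t0 a"
    using assms unfolding subtree_def by blast
  have aV: "a \<in> V" using a A_sub by blast
  \<comment> \<open>As \<open>w\<close> lies between \<open>t0\<close> and \<open>a\<close>, having
    its neighbour \<open>v\<close> on both sides would give a route from \<open>t0\<close> to
    \<open>a\<close> through \<open>v\<close> that is shorter by two.\<close>
  have "v \<notin> interval w t0 \<or> v \<notin> interval w a"
    using a gd_triangle[of t0 v a] gd_sym[of t0 w] gd_sym[of t0 v] V aV t0_V vw
    by (auto simp: interval_def)
  then obtain a1 where a1: "a1 \<in> A" "(w, a1) \<in> (avoid E v)\<^sup>*"
    using avoid_if_not_interval V aV t0_V a t0 by blast
  obtain a3 where a3: "a3 \<in> A" "v \<in> interval t0 a3"
    using assms unfolding subtree_def by blast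
  \<comment> \<open>Since \<open>v\<close> lies on a geodesic from \<open>t0\<close> to
    \<open>a3\<close>, these two points cannot both belong to the branch of
    \<open>w\<close>.\<close>
  have "\<exists>a2\<in>A. (w, a2) \<notin> (avoid E v)\<^sup>*"
  proof (rule ccontr)
    assume "\<not> ?thesis"
    then have *: "(w, t0) \<in> (avoid E v)\<^sup>*" "(w, a3) \<in> (avoid E v)\<^sup>*"
      using t0 a3 by auto
    then have "v \<noteq> t0" "v \<noteq> a3"
      using avoid_neq V by metis+
    moreover have "(t0, a3) \<in> (avoid E v)\<^sup>*"
      using * avoid_sym by (meson rtrancl_trans)
    ultimately show False
      using interval_separates a3 A_sub t0_V by blast
  qed
  then obtain a2 where a2: "a2 \<in> A" "(w, a2) \<notin> (avoid E v)\<^sup>*" by blast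
  let ?R = "{(a, b). a \<in> A \<and> b \<in> A \<and> real (gd a b) \<le> L}"
  have "sym ?R"
    using A_sub gd_sym by (fastforce simp: sym_def)
  then have "(a1, a2) \<in> ?R\<^sup>*"
    using chain[OF a1(1)] chain[OF a2(1)] sym_rtrancl by (meson rtrancl_trans symD)
  then have "(w, a2) \<in> (avoid E v)\<^sup>* \<or> ?thesis"
  proof (induction rule: rtrancl_induct)
    case (step x y)
    show ?case
    proof (cases "(w, x) \<in> (avoid E v)\<^sup>* \<and> (x, y) \<notin> (avoid E v)\<^sup>*")
      case True
      then have "v \<in> interval x y"
        using avoid_if_not_interval step A_sub by blast
      then have "gd x v \<le> gd x y"
        by (simp add: interval_def)
      with True step show ?thesis by force
    next
      case False
      with step show ?thesis by (meson rtrancl_trans)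
    qed
  qed (use a1 in auto)
  with a2 show ?thesis by blast
qed

text \<open>Each branch at \<open>v\<close> has a representative in \<open>A\<close> within
  \<open>L\<close> of \<open>v\<close>. Two of them are at most \<open>2 * L\<close> apart, so all
  lie in one ball centred at a point of \<open>A\<close>, where the hypothesis counts them.\<close>

lemma bounded_valence_subtree:
  assumes "\<And>a. a \<in> A \<Longrightarrow> finite {b \<in> A. real (gd a b) \<le> 2 * L} \<and> card {b \<in> A. real (gd a b) \<le> 2 * L} \<le> N"
  shows "bounded_valence subtree subtree_edges"
proof -
  have "finite {w. {v, w} \<in> subtree_edges} \<and> card {w. {v, w} \<in> subtree_edges} \<le> N"
    if v: "v \<in> subtree" for v
  proof -
    let ?W = "{w. {v, w} \<in> subtree_edges}"
    have "\<forall>w\<in>?W. \<exists>a. a \<in> A \<and> (w, a) \<in> (avoid E v)\<^sup>* \<and> real (gd a v) \<le> L"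
      using subtree_branch[OF v] unfolding subtree_edges_def by blast
    then obtain \<alpha> where \<alpha>: "\<And>w. w \<in> ?W \<Longrightarrow> \<alpha> w \<in> A \<and> (w, \<alpha> w) \<in> (avoid E v)\<^sup>* \<and> real (gd (\<alpha> w) v) \<le> L"
      by metis
    have inj: "inj_on \<alpha> ?W"
    proof (rule inj_onI, rule ccontr)
      fix w w' assume w: "w \<in> ?W" "w' \<in> ?W" "\<alpha> w = \<alpha> w'" "w \<noteq> w'"
      then have "(w, w') \<in> (avoid E v)\<^sup>*"
        using \<alpha> avoid_sym by (metis rtrancl_trans)
      with w show False
        using neighbours_separated unfolding subtree_edges_def by blast
    qed
    show ?thesis
    proof (cases "?W = {}")
      case False
      then obtain w where w: "w \<in> ?W" by blast
      have "\<alpha> ` ?W \<subseteq> {b \<in> A. real (gd (\<alpha> w) b) \<le> 2 * L}"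
      proof safe
        fix w' assume w': "{v, w'} \<in> subtree_edges"
        have V: "\<alpha> w \<in> V" "\<alpha> w' \<in> V" "v \<in> V"
          using \<alpha> w w' A_sub v subtree_sub by blast+
        show "\<alpha> w' \<in> A" using \<alpha> w' by blast
        have "real (gd (\<alpha> w) v) \<le> L" "real (gd (\<alpha> w') v) \<le> L"
          using \<alpha> w w' by auto
        then show "real (gd (\<alpha> w) (\<alpha> w')) \<le> 2 * L"
          using gd_triangle[of "\<alpha> w" v "\<alpha> w'"] gd_sym V by fastforce
      qed
      then show ?thesis
        using assms[of "\<alpha> w"] \<alpha>[OF w] inj
        by (meson card_inj_on_le inj_on_finite le_trans)
    next
      case True
      then show ?thesis by simp
    qed
  qed
  then show ?thesis unfolding bounded_valence_def by blast
qed

end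


section \<open>Relabelling the vertices of a tree\<close>

locale relabelled_tree = tree +
  fixes j :: "'a \<Rightarrow> 'b"
  assumes inj: "inj_on j V"
begin

lemma edge_iff: "u \<in> V \<Longrightarrow> v \<in> V \<Longrightarrow> {j u, j v} \<in> (`) j ` E \<longleftrightarrow> {u, v} \<in> E"
proof
  assume V: "u \<in> V" "v \<in> V" and "{j u, j v} \<in> (`) j ` E"
  then obtain e where e: "e \<in> E" "j ` e = j ` {u, v}" by auto
  then have "e \<subseteq> V" using simple unfolding simple_graph_def by blast
  with e V show "{u, v} \<in> E"
    using inj_on_image_eq_iff[OF inj, of e "{u, v}"] by auto
next
  assume "{u, v} \<in> E"
  then have "j ` {u, v} \<in> (`) j ` E" by (rule imageI)
  then show "{j u, j v} \<in> (`) j ` E" by simp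
qed

lemma walk_map: "set xs \<subseteq> V \<Longrightarrow> graph_walk (j ` V) ((`) j ` E) (map j xs) \<longleftrightarrow> graph_walk V E xs"
proof -
  assume xs: "set xs \<subseteq> V"
  have "successively (\<lambda>u v. {j u, j v} \<in> (`) j ` E) xs \<longleftrightarrow> successively (\<lambda>u v. {u, v} \<in> E) xs"
    using xs by (intro successively_cong refl edge_iff) blast+
  then show ?thesis
    using xs by (simp add: graph_walk_def successively_map image_mono)
qed

text \<open>Every walk of the image pulls back through \<open>inv_into\<close>; distance,
  connectedness and absence of cycles are all transferred by way of this equivalence.\<close>

lemma walk_image_iff:
  "graph_walk (j ` V) ((`) j ` E) ys \<longleftrightarrow> (\<exists>xs. ys = map j xs \<and> graph_walk V E xs)"
proof
  assume ys: "graph_walk (j ` V) ((`) j ` E) ys"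
  then have "set ys \<subseteq> j ` V" by (simp add: graph_walk_def)
  then have "set (map (inv_into V j) ys) \<subseteq> V" "map j (map (inv_into V j) ys) = ys"
    by (auto simp: subset_iff f_inv_into_f intro: inv_into_into intro!: map_idI)
  with ys walk_map show "\<exists>xs. ys = map j xs \<and> graph_walk V E xs" by metis
next
  assume "\<exists>xs. ys = map j xs \<and> graph_walk V E xs"
  then show "graph_walk (j ` V) ((`) j ` E) ys"
    using walk_map by (metis graph_walk_def)
qed

lemma walk_ends_iff:
  assumes "u \<in> V" "v \<in> V"
  shows "(\<exists>ys. graph_walk (j ` V) ((`) j ` E) ys \<and> hd ys = j u \<and> last ys = j v \<and> length ys = n)
    \<longleftrightarrow> (\<exists>xs. graph_walk V E xs \<and> hd xs = u \<and> last xs = v \<and> length xs = n)"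
proof -
  have "hd xs \<in> V \<and> last xs \<in> V \<and> xs \<noteq> []" if "graph_walk V E xs" for xs
    using that by (auto simp: graph_walk_def subset_iff)
  then have "hd (map j xs) = j u \<longleftrightarrow> hd xs = u" "last (map j xs) = j v \<longleftrightarrow> last xs = v"
    if "graph_walk V E xs" for xs
    using that assms inj by (simp_all add: hd_map last_map inj_on_eq_iff)
  then show ?thesis
    unfolding walk_image_iff by (metis length_map)
qed

lemma dist_image: "u \<in> V \<Longrightarrow> v \<in> V \<Longrightarrow> graph_dist (j ` V) ((`) j ` E) (j u) (j v) = gd u v"
  unfolding graph_dist_def by (simp add: walk_ends_iff)

lemma tree_image: "tree (j ` V) ((`) j ` E)"
proof
  show "simple_graph (j ` V) ((`) j ` E)"
    unfolding simple_graph_def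
  proof safe
    fix e assume "e \<in> E"
    then obtain u v where "e = {u, v}" "u \<in> V" "v \<in> V" "u \<noteq> v"
      using simple unfolding simple_graph_def by blast
    then show "\<exists>u v. j ` e = {u, v} \<and> u \<in> j ` V \<and> v \<in> j ` V \<and> u \<noteq> v"
      using inj by (intro exI[of _ "j u"] exI[of _ "j v"]) (auto simp: inj_on_eq_iff)
  qed
  show "graph_connected (j ` V) ((`) j ` E)"
    unfolding graph_connected_def
  proof (intro conjI ballI)
    fix u' v' assume "u' \<in> j ` V" "v' \<in> j ` V"
    then obtain u v where "u \<in> V" "v \<in> V" "u' = j u" "v' = j v" by blast
    then show "\<exists>xs. graph_walk (j ` V) ((`) j ` E) xs \<and> hd xs = u' \<and> last xs = v'"
      using connected walk_ends_iff unfolding graph_connected_def by metis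
  qed (use connected in \<open>simp add: graph_connected_def\<close>)
  show "\<nexists>xs. graph_cycle (j ` V) ((`) j ` E) xs"
  proof
    assume "\<exists>xs. graph_cycle (j ` V) ((`) j ` E) xs"
    then obtain xs where xs: "graph_walk V E xs" "graph_cycle (j ` V) ((`) j ` E) (map j xs)"
      unfolding graph_cycle_def walk_image_iff by blast
    then have "hd xs \<in> V" "last xs \<in> V" "xs \<noteq> []"
      by (auto simp: graph_walk_def subset_iff)
    with xs have "graph_cycle V E xs"
      by (auto simp: graph_cycle_def distinct_map hd_map last_map edge_iff)
    with acyclic show False by blast
  qed
qed

lemma bounded_valence_image:
  assumes "bounded_valence V E"
  shows "bounded_valence (j ` V) ((`) j ` E)"
proof -
  obtain k where k: "\<And>v. v \<in> V \<Longrightarrow> finite {w. {v, w} \<in> E} \<and> card {w. {v, w} \<in> E} \<le> k"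
    using assms unfolding bounded_valence_def by blast
  interpret J: tree "j ` V" "(`) j ` E" by (rule tree_image)
  have "finite {w. {j v, w} \<in> (`) j ` E} \<and> card {w. {j v, w} \<in> (`) j ` E} \<le> k" if "v \<in> V" for v
  proof -
    have "{w. {j v, w} \<in> (`) j ` E} = j ` {w. {v, w} \<in> E}"
    proof (intro equalityI subsetI)
      fix w' assume "w' \<in> {w. {j v, w} \<in> (`) j ` E}"
      then have w': "{j v, w'} \<in> (`) j ` E" by simp
      then obtain w where "w \<in> V" "w' = j w" using J.edge by blast
      with w' that show "w' \<in> j ` {w. {v, w} \<in> E}" by (simp add: edge_iff)
    next
      fix w' assume "w' \<in> j ` {w. {v, w} \<in> E}"
      then obtain w where "{v, w} \<in> E" "w' = j w" by blast
      then show "w' \<in> {w. {j v, w} \<in> (`) j ` E}"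
        using that edge edge_iff by simp
    qed
    then show ?thesis
      using k[OF that] card_image_le[of "{w. {v, w} \<in> E}" j] by simp
  qed
  then show ?thesis unfolding bounded_valence_def by blast
qed

end


section \<open>The realization of a graph is coarsely its vertex set\<close>

definition vertex_point :: "'v \<Rightarrow> 'v \<Rightarrow> real" where
  "vertex_point v = (\<lambda>x. if x = v then 1 else 0)"

text \<open>A coarse inverse of \<open>vertex_point\<close>. The choice need not respect a group
  action, but two possible choices are at distance at most 1, which is enough for coarse
  equivariance.\<close>

definition some_vertex :: "('v \<Rightarrow> real) \<Rightarrow> 'v" where
  "some_vertex p = (SOME v. v \<in> coord_supp p)"

lemma coord_supp_vertex_point [simp]: "coord_supp (vertex_point v) = {v}"
  by (auto simp: coord_supp_def vertex_point_def)

lemma some_vertex_vertex_point [simp]: "some_vertex (vertex_point v) = v"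
  by (simp add: some_vertex_def)

section \<open>Constants of quasi-isometric embeddings and of their composites\<close>

lemma qi_embeddingI:
  assumes "F ` X \<subseteq> Y" "K \<ge> 1" "c \<ge> 0"
    and "\<And>x x'. x \<in> X \<Longrightarrow> x' \<in> X \<Longrightarrow> dX x x' / K - c \<le> dY (F x) (F x')"
    and "\<And>x x'. x \<in> X \<Longrightarrow> x' \<in> X \<Longrightarrow> dY (F x) (F x') \<le> K * dX x x' + c"
  shows "qi_embedding X dX Y dY F"
  unfolding qi_embedding_def
  by (intro conjI exI[of _ K] exI[of _ c] ballI) (simp_all add: assms)

lemma qi_embeddingE:
  assumes "qi_embedding X dX Y dY F"
  obtains K c where "F ` X \<subseteq> Y" "K \<ge> 1" "c \<ge> 0"
    "\<And>x x'. x \<in> X \<Longrightarrow> x' \<in> X \<Longrightarrow> dX x x' \<le> K * (dY (F x) (F x') + c)"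
    "\<And>x x'. x \<in> X \<Longrightarrow> x' \<in> X \<Longrightarrow> dY (F x) (F x') \<le> K * dX x x' + c"
proof -
  obtain K c where *: "F ` X \<subseteq> Y" "K \<ge> 1" "c \<ge> 0"
    "\<forall>x\<in>X. \<forall>x'\<in>X. dX x x' / K - c \<le> dY (F x) (F x') \<and> dY (F x) (F x') \<le> K * dX x x' + c"
    using assms unfolding qi_embedding_def by blast
  have "dX x x' \<le> K * (dY (F x) (F x') + c)" if "x \<in> X" "x' \<in> X" for x x'
  proof -
    have "dX x x' / K \<le> dY (F x) (F x') + c" using *(4) that by force
    with *(2) show ?thesis by (simp add: pos_divide_le_eq mult.commute)
  qed
  then show thesis using *(4) by (intro that[OF *(1-3)]) simp_all
qed

lemma qi_embedding_comp:
  assumes "qi_embedding X dX Y dY F" "qi_embedding Y dY Z dZ H"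
  shows "qi_embedding X dX Z dZ (H \<circ> F)"
proof -
  obtain K c where F: "F ` X \<subseteq> Y" "K \<ge> 1" "c \<ge> 0"
    "\<And>x x'. x \<in> X \<Longrightarrow> x' \<in> X \<Longrightarrow> dX x x' \<le> K * (dY (F x) (F x') + c)"
    "\<And>x x'. x \<in> X \<Longrightarrow> x' \<in> X \<Longrightarrow> dY (F x) (F x') \<le> K * dX x x' + c"
    using qi_embeddingE[OF assms(1)] by blast
  obtain K' c' where H: "H ` Y \<subseteq> Z" "K' \<ge> 1" "c' \<ge> 0"
    "\<And>x x'. x \<in> Y \<Longrightarrow> x' \<in> Y \<Longrightarrow> dY x x' \<le> K' * (dZ (H x) (H x') + c')"
    "\<And>x x'. x \<in> Y \<Longrightarrow> x' \<in> Y \<Longrightarrow> dZ (H x) (H x') \<le> K' * dY x x' + c'"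
    using qi_embeddingE[OF assms(2)] by blast
  show ?thesis
  \<comment> \<open>The upper estimate produces the additive error \<open>K' * c + c'\<close>, the
    lower one \<open>c' + c / K'\<close>; as \<open>K' \<ge> 1\<close>, the sum below dominates
    both.\<close>
  proof (rule qi_embeddingI[where K = "K * K'" and c = "K' * c + c' + c"])
    show "(H \<circ> F) ` X \<subseteq> Z" using F(1) H(1) by auto
    show "K * K' \<ge> 1" using mult_mono[OF F(2) H(2)] F(2) by simp
    show "K' * c + c' + c \<ge> 0" using F H by simp
  next
    fix x x' assume x: "x \<in> X" "x' \<in> X"
    then have y: "F x \<in> Y" "F x' \<in> Y" using F(1) by auto
    have "dX x x' \<le> K * (dY (F x) (F x') + c)"
      by (rule F(4)[OF x])
    also have "\<dots> \<le> K * (K' * (dZ (H (F x)) (H (F x')) + c') + c)"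
      using H(4)[OF y] F(2) by (intro mult_left_mono) auto
    also have "\<dots> \<le> K * (K' * (dZ (H (F x)) (H (F x')) + c') + K' * (K' * c + c))"
      using F(2,3) H(2) mult_right_mono[of 1 "K' * K'" c] mult_right_mono[of 1 K' c]
        mult_mono[of 1 K' 1 K']
      by (intro mult_left_mono add_left_mono) (auto simp: algebra_simps)
    finally have "dX x x' \<le> (dZ (H (F x)) (H (F x')) + (K' * c + c' + c)) * (K * K')"
      by (simp add: algebra_simps)
    moreover have "K * K' > 0"
      using F(2) H(2) by simp
    ultimately have "dX x x' / (K * K') \<le> dZ (H (F x)) (H (F x')) + (K' * c + c' + c)"
      by (simp only: pos_divide_le_eq)
    then show "dX x x' / (K * K') - (K' * c + c' + c) \<le> dZ ((H \<circ> F) x) ((H \<circ> F) x')"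
      by simp
    have "dZ (H (F x)) (H (F x')) \<le> K' * dY (F x) (F x') + c'"
      by (rule H(5)[OF y])
    also have "\<dots> \<le> K' * (K * dX x x' + c) + c'"
      using F(5)[OF x] H(2) by (intro add_right_mono mult_left_mono) auto
    finally show "dZ ((H \<circ> F) x) ((H \<circ> F) x') \<le> K * K' * dX x x' + (K' * c + c' + c)"
      using F(3) by (simp add: algebra_simps)
  qed
qed

context connected_graph
begin

lemma realizationD:
  assumes "p \<in> realization V E"
  shows "finite (coord_supp p)" "coord_supp p \<noteq> {}" "coord_supp p \<subseteq> V"
    "u \<in> coord_supp p \<Longrightarrow> v \<in> coord_supp p \<Longrightarrow> gd u v \<le> 1"
    "0 \<le> p u" "p u \<le> 1" "(\<Sum>v\<in>coord_supp p. p v) = 1"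
proof -
  have p: "\<And>v. 0 \<le> p v" "coord_supp p \<in> E \<or> (\<exists>v\<in>V. coord_supp p = {v})"
    "(\<Sum>v\<in>coord_supp p. p v) = 1"
    using assms unfolding realization_def by auto
  \<comment> \<open>Admitting \<open>a = b\<close> treats vertices and inner points of edges
    alike.\<close>
  obtain a b where ab: "coord_supp p = {a, b}" "a \<in> V" "b \<in> V" "a = b \<or> {a, b} \<in> E"
  proof (cases "coord_supp p \<in> E")
    case True
    then have "coord_supp p \<in> {{u, v} | u v. u \<in> V \<and> v \<in> V \<and> u \<noteq> v}"
      using simple unfolding simple_graph_def by blast
    then show thesis using that True by auto
  next
    case False
    then show thesis using that p(2) by fastforce
  qed
  then show "finite (coord_supp p)" "coord_supp p \<noteq> {}" "coord_supp p \<subseteq> V" by auto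
  show "gd u v \<le> 1" if "u \<in> coord_supp p" "v \<in> coord_supp p"
    using that ab gd_edge[of a b] gd_edge[of b a] by (auto simp: insert_commute)
  show "0 \<le> p u" "(\<Sum>v\<in>coord_supp p. p v) = 1" using p by auto
  show "p u \<le> 1"
  proof (cases "u \<in> coord_supp p")
    case True
    then have "p u \<le> (\<Sum>v\<in>coord_supp p. p v)"
      using ab p(1) by (intro member_le_sum) auto
    then show ?thesis using p(3) by simp
  qed (simp add: coord_supp_def)
qed

text \<open>For points on no common edge, the ends realising the minimum differ from
  \<open>u\<close> and \<open>v\<close> by at most one edge each, and the two partial edges have
  length at most 1 each: 4 in total. On a common edge both distances lie between 0 and 1.\<close>

lemma realization_dist_approx:
  assumes p: "p \<in> realization V E" and q: "q \<in> realization V E"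
    and u: "u \<in> coord_supp p" and v: "v \<in> coord_supp q"
  shows "\<bar>realization_dist V E p q - real (gd u v)\<bar> \<le> 4"
proof (cases "\<exists>e\<in>E. coord_supp p \<union> coord_supp q \<subseteq> e")
  case True
  let ?S = "coord_supp p \<union> coord_supp q"
  have fin: "finite ?S" using realizationD(1) p q by blast
  obtain e where e: "e \<in> E" "u \<in> e" "v \<in> e" using True u v by blast
  then have "e \<in> {{u, v} | u v. u \<in> V \<and> v \<in> V \<and> u \<noteq> v}"
    using simple unfolding simple_graph_def by blast
  with e have "gd u v \<le> 1"
    using gd_edge by (auto simp: insert_commute)
  have "(\<Sum>x\<in>coord_supp p. p x) = (\<Sum>x\<in>?S. p x)"
    using fin by (intro sum.mono_neutral_left) (simp_all add: coord_supp_def)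
  moreover have "(\<Sum>x\<in>coord_supp q. q x) = (\<Sum>x\<in>?S. q x)"
    using fin by (intro sum.mono_neutral_left) (simp_all add: coord_supp_def)
  \<comment> \<open>Both coordinate vectors are nonnegative with sum 1, so half their l1 distance is
    at most 1.\<close>
  moreover have "(\<Sum>x\<in>?S. \<bar>p x - q x\<bar>) \<le> (\<Sum>x\<in>?S. p x + q x)"
  proof (rule sum_mono)
    fix x show "\<bar>p x - q x\<bar> \<le> p x + q x"
      using realizationD(5)[OF p, of x] realizationD(5)[OF q, of x] by linarith
  qed
  moreover have "0 \<le> (\<Sum>x\<in>?S. \<bar>p x - q x\<bar>)" by (rule sum_nonneg) simp
  ultimately have "0 \<le> (\<Sum>x\<in>?S. \<bar>p x - q x\<bar>)" "(\<Sum>x\<in>?S. \<bar>p x - q x\<bar>) \<le> 2"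
    using realizationD(7)[OF p] realizationD(7)[OF q] by (simp_all only: sum.distrib)
  moreover have "realization_dist V E p q = (\<Sum>x\<in>?S. \<bar>p x - q x\<bar>) / 2"
    using True by (simp add: realization_dist_def)
  ultimately show ?thesis
    using \<open>gd u v \<le> 1\<close> by linarith
next
  case False
  let ?M = "{(1 - p u) + real (gd u v) + (1 - q v) | u v. u \<in> coord_supp p \<and> v \<in> coord_supp q}"
  have "?M = (\<lambda>(u, v). (1 - p u) + real (gd u v) + (1 - q v)) ` (coord_supp p \<times> coord_supp q)"
    by auto
  then have "finite ?M" "?M \<noteq> {}"
    using realizationD(1,2) p q by auto
  then have "Min ?M \<in> ?M" by (rule Min_in)
  then obtain u' v' where M: "u' \<in> coord_supp p" "v' \<in> coord_supp q"
    "Min ?M = (1 - p u') + real (gd u' v') + (1 - q v')" by blast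
  have V: "u \<in> V" "u' \<in> V" "v \<in> V" "v' \<in> V"
    using u v M realizationD(3) p q by blast+
  have "gd u v \<le> gd u u' + (gd u' v' + gd v' v)" "gd u' v' \<le> gd u' u + (gd u v + gd v v')"
    using V gd_triangle by (meson add_left_mono order_trans)+
  moreover have "gd u u' \<le> 1" "gd u' u \<le> 1" "gd v v' \<le> 1" "gd v' v \<le> 1"
    using realizationD(4) p q u v M by blast+
  moreover have "0 \<le> p u'" "p u' \<le> 1" "0 \<le> q v'" "q v' \<le> 1"
    using realizationD(5,6) p q by blast+
  moreover have "realization_dist V E p q = (1 - p u') + real (gd u' v') + (1 - q v')"
    using M(3) unfolding realization_dist_def if_not_P[OF False] .
  ultimately show ?thesis by linarith
qed

lemma some_vertex_in: "p \<in> realization V E \<Longrightarrow> some_vertex p \<in> coord_supp p"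
  using realizationD(2) unfolding some_vertex_def by (metis all_not_in_conv someI_ex)

lemma some_vertex_V: "p \<in> realization V E \<Longrightarrow> some_vertex p \<in> V"
  using some_vertex_in realizationD(3) by blast

lemma vertex_point_in: "v \<in> V \<Longrightarrow> vertex_point v \<in> realization V E"
  by (auto simp: realization_def) (auto simp: vertex_point_def)

lemma qi_vertex_point:
  "qi_embedding V (\<lambda>u v. real (gd u v)) (realization V E) (realization_dist V E) vertex_point"
proof (rule qi_embeddingI[where K = 1 and c = 4])
  fix u v assume "u \<in> V" "v \<in> V"
  then have "\<bar>realization_dist V E (vertex_point u) (vertex_point v) - real (gd u v)\<bar> \<le> 4"
    by (intro realization_dist_approx vertex_point_in) auto
  then show "real (gd u v) / 1 - 4 \<le> realization_dist V E (vertex_point u) (vertex_point v)"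
    "realization_dist V E (vertex_point u) (vertex_point v) \<le> 1 * real (gd u v) + 4"
    by linarith+
qed (auto simp: vertex_point_in)

lemma qi_some_vertex:
  "qi_embedding (realization V E) (realization_dist V E) V (\<lambda>u v. real (gd u v)) some_vertex"
proof (rule qi_embeddingI[where K = 1 and c = 4])
  fix p q assume "p \<in> realization V E" "q \<in> realization V E"
  then have "\<bar>realization_dist V E p q - real (gd (some_vertex p) (some_vertex q))\<bar> \<le> 4"
    by (intro realization_dist_approx some_vertex_in)
  then show "realization_dist V E p q / 1 - 4 \<le> real (gd (some_vertex p) (some_vertex q))"
    "real (gd (some_vertex p) (some_vertex q)) \<le> 1 * realization_dist V E p q + 4"
    by linarith+
qed (auto simp: some_vertex_V)

end

lemma quasi_isometric_realization:
  assumes "connected_graph V E" "connected_graph V' E'"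
    and H: "qi_embedding V (\<lambda>u v. real (graph_dist V E u v)) V' (\<lambda>u v. real (graph_dist V' E' u v)) H"
    and dense: "\<And>w. w \<in> V' \<Longrightarrow> \<exists>v\<in>V. real (graph_dist V' E' (H v) w) \<le> C"
  shows "quasi_isometric (realization V E) (realization_dist V E)
    (realization V' E') (realization_dist V' E')"
proof -
  interpret X: connected_graph V E by fact
  interpret Y: connected_graph V' E' by fact
  let ?F = "vertex_point \<circ> H \<circ> some_vertex"
  have "qi_embedding (realization V E) (realization_dist V E)
    (realization V' E') (realization_dist V' E') ?F"
    using qi_embedding_comp[OF X.qi_some_vertex qi_embedding_comp[OF H Y.qi_vertex_point]]
    by (simp add: comp_assoc)
  \<comment> \<open>The density constant has to be nonnegative, while \<open>C\<close> may have any
    sign; the 4 comes from replacing \<open>q\<close> by a vertex.\<close>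
  moreover have "\<exists>p\<in>realization V E. realization_dist V' E' (?F p) q \<le> max 0 C + 4"
    if q: "q \<in> realization V' E'" for q
  proof -
    obtain v where v: "v \<in> V" "real (Y.gd (H v) (some_vertex q)) \<le> C"
      using dense Y.some_vertex_V[OF q] by blast
    then have "H v \<in> V'" using H unfolding qi_embedding_def by blast
    then have "\<bar>realization_dist V' E' (vertex_point (H v)) q - real (Y.gd (H v) (some_vertex q))\<bar> \<le> 4"
      using q by (intro Y.realization_dist_approx Y.vertex_point_in Y.some_vertex_in) auto
    with v have "realization_dist V' E' (?F (vertex_point v)) q \<le> max 0 C + 4"
      by simp
    then show ?thesis using X.vertex_point_in[OF v(1)] by blast
  qed
  ultimately show ?thesis
    unfolding quasi_isometric_def quasi_isometry_def
    by (intro exI[of _ ?F] conjI exI[of _ "max 0 C + 4"]) auto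
qed


section \<open>Coarse images of countable graphs in trees\<close>

lemma ex_tree_of_qi_embedding:
  fixes X :: "'x set" and V :: "'t set"
  assumes "connected_graph X D" "tree V E" "countable X"
    and h: "qi_embedding X (\<lambda>x y. real (graph_dist X D x y)) V (\<lambda>u v. real (graph_dist V E u v)) h"
  shows "\<exists>(V' :: nat set) E'. simplicial_tree V' E' \<and>
    quasi_isometric (realization X D) (realization_dist X D) (realization V' E') (realization_dist V' E') \<and>
    ((\<forall>R. \<exists>N. \<forall>x\<in>X. finite {y \<in> X. real (graph_dist X D x y) \<le> R} \<and>
        card {y \<in> X. real (graph_dist X D x y) \<le> R} \<le> N) \<longrightarrow> bounded_valence V' E')"
proof -
  interpret X: connected_graph X D by fact
  interpret T: tree V E by fact
  obtain K c where hV: "h ` X \<subseteq> V" and K: "K \<ge> 1" and c: "c \<ge> 0"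
    and lower: "\<And>x y. x \<in> X \<Longrightarrow> y \<in> X \<Longrightarrow> real (X.gd x y) \<le> K * (real (T.gd (h x) (h y)) + c)"
    and upper: "\<And>x y. x \<in> X \<Longrightarrow> y \<in> X \<Longrightarrow> real (T.gd (h x) (h y)) \<le> K * real (X.gd x y) + c"
    using qi_embeddingE[OF h] by blast
  \<comment> \<open>The upper bound on the distance between images of adjacent vertices, so that a
    walk in the graph becomes a chain with jumps at most \<open>L\<close>.\<close>
  define L where "L = K + c"
  obtain x0 where x0: "x0 \<in> X"
    using X.connected unfolding graph_connected_def by blast
  let ?R = "{(a, b). a \<in> h ` X \<and> b \<in> h ` X \<and> real (T.gd a b) \<le> L}"
  have chain: "(h x0, h x) \<in> ?R\<^sup>*" if "x \<in> X" for x
  proof -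
    have "(x0, x) \<in> (adj D)\<^sup>*"
      using X.gd_walk[OF x0 that] by (rule relpow_imp_rtrancl)
    then show ?thesis
    proof (induction rule: rtrancl_induct)
      case (step y z)
      then have e: "{y, z} \<in> D" by (simp add: adj_def)
      have "real (T.gd (h y) (h z)) \<le> L"
        using upper[of y z] X.edge[OF e] X.gd_edge[OF e] by (simp add: L_def)
      then have "(h y, h z) \<in> ?R" using X.edge[OF e] by blast
      with step.IH show ?case by (rule rtrancl_into_rtrancl)
    qed simp
  qed
  interpret tree_hull V E "h ` X" "h x0" L
    using hV x0 K c chain by unfold_locales (auto simp: L_def)
  \<comment> \<open>\<open>to_nat_on\<close> is injective on every countable set, whether finite or
    infinite.\<close>
  define j where "j = to_nat_on subtree"
  have "countable subtree" using countable_subtree assms(3) by simp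
  interpret S: tree subtree subtree_edges by (rule tree_subtree)
  interpret J: relabelled_tree subtree subtree_edges j
    using \<open>countable subtree\<close> by unfold_locales (simp add: j_def inj_on_to_nat_on)
  define V' where "V' = j ` subtree"
  define E' where "E' = (`) j ` subtree_edges"
  interpret J': tree V' E' unfolding V'_def E'_def by (rule J.tree_image)
  have dist: "J'.gd (j u) (j v) = T.gd u v" if "u \<in> subtree" "v \<in> subtree" for u v
    unfolding V'_def E'_def using J.dist_image[OF that] subtree_dist[OF that] by simp
  have hS: "h x \<in> subtree" if "x \<in> X" for x using that A_subtree by blast
  have qi: "qi_embedding X (\<lambda>x y. real (X.gd x y)) V' (\<lambda>u v. real (J'.gd u v)) (j \<circ> h)"
    using h hS dist unfolding qi_embedding_def by (auto simp: V'_def)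
  have dense: "\<exists>x\<in>X. real (J'.gd ((j \<circ> h) x) w) \<le> L" if w: "w \<in> V'" for w
    using w subtree_near dist hS by (fastforce simp: V'_def)
  have "quasi_isometric (realization X D) (realization_dist X D) (realization V' E') (realization_dist V' E')"
    by (rule quasi_isometric_realization[OF assms(1) J'.connected_graph_axioms qi dense])
  moreover have "bounded_valence V' E'"
    if lf: "\<forall>R. \<exists>N. \<forall>x\<in>X. finite {y \<in> X. real (X.gd x y) \<le> R} \<and> card {y \<in> X. real (X.gd x y) \<le> R} \<le> N"
  proof -
    \<comment> \<open>By the lower estimate for \<open>h\<close>, images at most
      \<open>2 * L\<close> apart come from points at most \<open>R\<close> apart.\<close>
    define R where "R = K * (2 * L + c)"
    obtain N where N: "\<And>x. x \<in> X \<Longrightarrow> finite {y \<in> X. real (X.gd x y) \<le> R} \<and> card {y \<in> X. real (X.gd x y) \<le> R} \<le> N"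
      using lf by meson
    have "finite {b \<in> h ` X. real (T.gd a b) \<le> 2 * L} \<and> card {b \<in> h ` X. real (T.gd a b) \<le> 2 * L} \<le> N"
      if a: "a \<in> h ` X" for a
    proof -
      obtain x where x: "x \<in> X" "a = h x" using a by blast
      let ?B = "{y \<in> X. real (X.gd x y) \<le> R}"
      have "y \<in> ?B" if y: "y \<in> X" "real (T.gd a (h y)) \<le> 2 * L" for y
      proof -
        have "K * (real (T.gd (h x) (h y)) + c) \<le> R"
          unfolding R_def using y K x by (intro mult_left_mono) auto
        with lower[OF x(1) y(1)] y show ?thesis by simp
      qed
      then have sub: "{b \<in> h ` X. real (T.gd a b) \<le> 2 * L} \<subseteq> h ` ?B" by blast
      have "finite ?B" "card ?B \<le> N" using N[OF x(1)] by auto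
      with sub show ?thesis
        by (meson card_image_le card_mono finite_imageI finite_subset le_trans)
    qed
    then have "bounded_valence subtree subtree_edges" by (rule bounded_valence_subtree)
    then show ?thesis unfolding V'_def E'_def by (rule J.bounded_valence_image)
  qed
  ultimately show ?thesis
    using J'.tree_axioms simplicial_tree_iff by blast
qed


section \<open>Orbits of finitely generated groups\<close>

text \<open>Each element is the product of a finite word over the generators and their inverses, and
  there are countably many such words.\<close>

lemma (in group) countable_generate:
  assumes "countable S" "S \<subseteq> carrier G"
  shows "countable (generate G S)"
proof -
  define S' where "S' = S \<union> (\<lambda>s. inv s) ` S"
  define w where "w = (\<lambda>xs. foldr (\<otimes>) xs \<one>)"
  have S': "S' \<subseteq> carrier G" using assms(2) by (auto simp: S'_def)
  have w_closed: "w xs \<in> carrier G" if "xs \<in> lists S'" for xs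
    using that S' by (induction xs) (auto simp: w_def)
  have w_append: "w (xs @ ys) = w xs \<otimes> w ys" if "xs \<in> lists S'" "ys \<in> lists S'" for xs ys
    using that(1)
  proof (induction xs)
    case Nil
    then show ?case using w_closed[OF that(2)] by (simp add: w_def)
  next
    case (Cons x xs)
    then have "x \<in> carrier G" using S' by auto
    with Cons show ?case
      using w_closed[OF that(2)] w_closed[of xs] by (simp add: w_def m_assoc)
  qed
  have "g \<in> w ` lists S'" if "g \<in> generate G S" for g
    using that
  proof induction
    case one
    have "w [] = \<one>" by (simp add: w_def)
    then show ?case by (metis image_eqI lists.Nil)
  next
    case (incl h)
    then have "w [h] = h" "[h] \<in> lists S'"
      using assms(2) by (auto simp: w_def S'_def)
    then show ?case by (metis image_eqI)
  next
    case (inv h)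
    then have "w [inv h] = inv h" "[inv h] \<in> lists S'"
      using assms(2) by (auto simp: w_def S'_def)
    then show ?case by (metis image_eqI)
  next
    case (eng h1 h2)
    then obtain xs ys where xs: "xs \<in> lists S'" "ys \<in> lists S'" "h1 = w xs" "h2 = w ys" by blast
    then have "h1 \<otimes> h2 = w (xs @ ys)" "xs @ ys \<in> lists S'"
      by (auto simp: w_append)
    then show ?case by blast
  qed
  moreover have "countable (lists S')"
    using assms(1) by (auto simp: S'_def)
  ultimately show ?thesis
    by (meson countable_image countable_subset subsetI)
qed

locale isometric_orbit =
  fixes G :: "('g, 'm) monoid_scheme" and \<phi> :: "'g \<Rightarrow> 'q \<Rightarrow> 'q" and Q :: "'q set"
    and d :: "'q \<Rightarrow> 'q \<Rightarrow> real" and x0 :: 'q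
  assumes group: "group G" and fg: "finitely_generated G"
    and metric: "Metric_space Q d" and isometric: "isometric_action G \<phi> Q d" and x0: "x0 \<in> Q"
begin

sublocale group G by (rule group)

sublocale group_action G Q \<phi>
  using isometric by (simp add: isometric_action_def)

sublocale Metric_space Q d by (rule metric)

abbreviation Orb :: "'q set" where
  "Orb \<equiv> orbit G \<phi> x0"

abbreviation redges :: "real \<Rightarrow> 'q set set" where
  "redges r \<equiv> rips_edges Orb d r"

lemma isom: "g \<in> carrier G \<Longrightarrow> x \<in> Q \<Longrightarrow> y \<in> Q \<Longrightarrow> d (\<phi> g x) (\<phi> g y) = d x y"
  using isometric unfolding isometric_action_def by blast

lemma Orb_sub: "Orb \<subseteq> Q"
  using element_image x0 unfolding orbit_def by blast

lemma x0_Orb: "x0 \<in> Orb"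
  by (rule orbit_refl[OF x0])

lemma act_Orb:
  assumes "g \<in> carrier G" "y \<in> Orb"
  shows "\<phi> g y \<in> Orb"
proof -
  obtain h where h: "h \<in> carrier G" "y = \<phi> h x0"
    using assms unfolding orbit_def by blast
  then have "\<phi> g y = \<phi> (g \<otimes>\<^bsub>G\<^esub> h) x0"
    using composition_rule[OF x0 assms(1) h(1)] by simp
  with h assms show ?thesis unfolding orbit_def by blast
qed

lemma act_inv: "g \<in> carrier G \<Longrightarrow> y \<in> Q \<Longrightarrow> \<phi> (inv\<^bsub>G\<^esub> g) (\<phi> g y) = y"
  using orbit_sym_aux by blast

lemma inv_act: "g \<in> carrier G \<Longrightarrow> y \<in> Q \<Longrightarrow> \<phi> g (\<phi> (inv\<^bsub>G\<^esub> g) y) = y"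
  using orbit_sym_aux[of "inv\<^bsub>G\<^esub> g" y] by simp

lemma countable_Orb: "countable Orb"
proof -
  obtain S where "finite S" "S \<subseteq> carrier G" "generate G S = carrier G"
    using fg unfolding finitely_generated_def by blast
  then have "countable (carrier G)"
    using countable_generate[of S] countable_finite by metis
  moreover have "Orb = (\<lambda>g. \<phi> g x0) ` carrier G"
    by (auto simp: orbit_def)
  ultimately show ?thesis by simp
qed

text \<open>Chains are built along products: a chain from \<open>x0\<close> to the image of
  \<open>x0\<close> under \<open>h1\<close> is followed by the translate by \<open>h1\<close> of a
  chain for \<open>h2\<close>. Translation preserves jump lengths because the action is
  isometric.\<close>

lemma Orb_chain:
  obtains r0 where "r0 \<ge> 0"
    "\<And>x. x \<in> Orb \<Longrightarrow> (x0, x) \<in> {(a, b). a \<in> Orb \<and> b \<in> Orb \<and> d a b \<le> r0}\<^sup>*"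
proof -
  obtain S where S: "finite S" "S \<subseteq> carrier G" "generate G S = carrier G"
    using fg unfolding finitely_generated_def by blast
  \<comment> \<open>A sum in place of a maximum bounds the displacement of every generator and also
    covers an empty \<open>S\<close>.\<close>
  define r0 where "r0 = (\<Sum>s\<in>S. d x0 (\<phi> s x0))"
  have r0: "d x0 (\<phi> s x0) \<le> r0" if "s \<in> S" for s
    unfolding r0_def using that S(1) by (intro member_le_sum) auto
  let ?R = "{(a, b). a \<in> Orb \<and> b \<in> Orb \<and> d a b \<le> r0}"
  have transl: "(\<phi> g x, \<phi> g y) \<in> ?R\<^sup>*" if "(x, y) \<in> ?R\<^sup>*" "g \<in> carrier G" for g x y
    using that(1)
  proof (induction rule: rtrancl_induct)
    case (step y z)
    then have "(\<phi> g y, \<phi> g z) \<in> ?R"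
      using isom act_Orb that(2) Orb_sub by (auto simp: subset_iff)
    with step.IH show ?case by (rule rtrancl_into_rtrancl)
  qed simp
  have "g \<in> carrier G \<and> (x0, \<phi> g x0) \<in> ?R\<^sup>*" if "g \<in> generate G S" for g
    using that
  proof induction
    case one
    have "\<phi> \<one>\<^bsub>G\<^esub> x0 = x0"
      using act_inv[OF one_closed x0] composition_rule[OF x0 one_closed one_closed] by simp
    then show ?case by simp
  next
    case (incl h)
    then have "(x0, \<phi> h x0) \<in> ?R"
      using r0 x0_Orb act_Orb S(2) by blast
    with incl S(2) show ?case by blast
  next
    case (inv h)
    then have h: "h \<in> carrier G" using S(2) by blast
    have "d x0 (\<phi> (inv\<^bsub>G\<^esub> h) x0) = d (\<phi> h x0) (\<phi> h (\<phi> (inv\<^bsub>G\<^esub> h) x0))"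
      using isom h x0 element_image by (metis inv_closed)
    also have "\<dots> = d x0 (\<phi> h x0)"
      using h x0 by (simp add: inv_act commute)
    finally have "(x0, \<phi> (inv\<^bsub>G\<^esub> h) x0) \<in> ?R"
      using r0[OF inv] x0_Orb act_Orb h by simp
    with h show ?case by blast
  next
    case (eng h1 h2)
    then have h: "h1 \<in> carrier G" "h2 \<in> carrier G"
      and chains: "(x0, \<phi> h1 x0) \<in> ?R\<^sup>*" "(x0, \<phi> h2 x0) \<in> ?R\<^sup>*" by auto
    have "(x0, \<phi> h1 (\<phi> h2 x0)) \<in> ?R\<^sup>*"
      using chains(1) transl[OF chains(2) h(1)] by (rule rtrancl_trans)
    with h show ?case by (simp only: composition_rule[OF x0 h] m_closed simp_thms)
  qed
  then have "(x0, x) \<in> ?R\<^sup>*" if "x \<in> Orb" for x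
    using that S(3) unfolding orbit_def by blast
  moreover have "r0 \<ge> 0" unfolding r0_def by (intro sum_nonneg) simp
  ultimately show thesis using that by blast
qed

section \<open>The metric of the Rips graph against the metric of Q\<close>

lemma redges_iff: "{u, v} \<in> redges r \<longleftrightarrow> u \<in> Orb \<and> v \<in> Orb \<and> u \<noteq> v \<and> d u v \<le> r"
  by (auto simp: rips_edges_def doubleton_eq_iff commute)

lemma redges_simple: "simple_graph Orb (redges r)"
  unfolding simple_graph_def rips_edges_def by blast

lemma d_le_gd:
  assumes "connected_graph Orb (redges r)" "u \<in> Orb" "v \<in> Orb"
  shows "d u v \<le> r * real (graph_dist Orb (redges r) u v)"
proof -
  interpret X: connected_graph Orb "redges r" by fact
  have "d u v \<le> r * real n" if "(u, v) \<in> adj (redges r) ^^ n" for n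
    using that assms(3)
  proof (induction n arbitrary: v)
    case 0
    then show ?case using assms(2) Orb_sub by auto
  next
    case (Suc n)
    then obtain w where w: "(u, w) \<in> adj (redges r) ^^ n" "w \<in> Orb" "d w v \<le> r"
      by (auto simp: adj_def redges_iff)
    have "d u v \<le> d u w + d w v"
      using assms(2) w(2) Suc.prems(2) Orb_sub by (intro triangle) auto
    with Suc.IH[OF w(1,2)] w(3) show ?case by (simp add: algebra_simps)
  qed
  then show ?thesis using X.gd_walk assms(2,3) by blast
qed

lemma ball_translate:
  assumes "g \<in> carrier G"
  shows "{y \<in> Orb. d y (\<phi> g x0) \<le> R} = \<phi> g ` {y \<in> Orb. d y x0 \<le> R}"
proof (intro equalityI subsetI)
  fix y assume "y \<in> {y \<in> Orb. d y (\<phi> g x0) \<le> R}"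
  then have y: "y \<in> Orb" "d y (\<phi> g x0) \<le> R" "y \<in> Q" using Orb_sub by auto
  let ?y = "\<phi> (inv\<^bsub>G\<^esub> g) y"
  have "?y \<in> Orb" using act_Orb y assms by simp
  moreover have "d ?y x0 = d y (\<phi> g x0)"
    using isom[of g ?y x0] inv_act assms y x0 \<open>?y \<in> Orb\<close> Orb_sub by auto
  ultimately have "?y \<in> {y \<in> Orb. d y x0 \<le> R}" using y by simp
  moreover have "y = \<phi> g ?y" using inv_act assms y by simp
  ultimately show "y \<in> \<phi> g ` {y \<in> Orb. d y x0 \<le> R}" by blast
next
  fix y assume "y \<in> \<phi> g ` {y \<in> Orb. d y x0 \<le> R}"
  then show "y \<in> {y \<in> Orb. d y (\<phi> g x0) \<le> R}"
    using isom act_Orb assms x0 Orb_sub by auto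
qed

text \<open>Local finiteness speaks of balls around \<open>x0\<close> only. The action is transitive
  on the orbit and isometric, so a single ball at \<open>x0\<close> bounds the balls at all other
  points.\<close>

lemma uniformly_locally_finite:
  assumes X: "connected_graph Orb (redges r)" and lf: "locally_finite_orbit G \<phi> d x0" and r: "r > 0"
  shows "\<exists>N. \<forall>x\<in>Orb. finite {y \<in> Orb. real (graph_dist Orb (redges r) x y) \<le> R} \<and>
    card {y \<in> Orb. real (graph_dist Orb (redges r) x y) \<le> R} \<le> N"
proof -
  \<comment> \<open>The maximum with 0 covers negative \<open>R\<close>, as local finiteness
    concerns nonnegative radii.\<close>
  define B where "B = {y \<in> Orb. d y x0 \<le> max 0 (r * R)}"
  have "finite B" using lf unfolding B_def locally_finite_orbit_def by simp
  have "finite {y \<in> Orb. real (graph_dist Orb (redges r) x y) \<le> R} \<and>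
    card {y \<in> Orb. real (graph_dist Orb (redges r) x y) \<le> R} \<le> card B" if x: "x \<in> Orb" for x
  proof -
    obtain g where g: "g \<in> carrier G" "x = \<phi> g x0"
      using x unfolding orbit_def by blast
    have "d y x \<le> max 0 (r * R)" if y: "y \<in> Orb" "real (graph_dist Orb (redges r) x y) \<le> R" for y
    proof -
      have "d x y \<le> r * R"
        using d_le_gd[OF X x y(1)] mult_left_mono[OF y(2), of r] r by linarith
      then show ?thesis by (simp add: commute)
    qed
    then have "{y \<in> Orb. real (graph_dist Orb (redges r) x y) \<le> R} \<subseteq> \<phi> g ` B"
      unfolding B_def ball_translate[OF g(1), symmetric] using g by blast
    then show ?thesis
      using \<open>finite B\<close> by (meson card_image_le card_mono finite_imageI finite_subset le_trans)
  qed
  then show ?thesis by blast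
qed

text \<open>Discretise a geodesic of the tree between the images of two orbit points: by the bottleneck
  property each of its vertices is near the image of an orbit point, which gives a walk in the
  Rips graph of comparable length.\<close>

lemma Rips_walk:
  assumes T: "tree V E" and h: "qi_embedding Q d V (\<lambda>u v. real (graph_dist V E u v)) h"
  obtains r K c where "r \<ge> 1" "K \<ge> 1" "c \<ge> 0"
    "\<And>x y. x \<in> Orb \<Longrightarrow> y \<in> Orb \<Longrightarrow> \<exists>n. (x, y) \<in> adj (redges r) ^^ n \<and> real n \<le> K * d x y + c"
proof -
  interpret T: tree V E by fact
  obtain K c where hV: "h ` Q \<subseteq> V" and K: "K \<ge> 1" and c: "c \<ge> 0"
    and lower: "\<And>x y. x \<in> Q \<Longrightarrow> y \<in> Q \<Longrightarrow> d x y \<le> K * (real (T.gd (h x) (h y)) + c)"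
    and upper: "\<And>x y. x \<in> Q \<Longrightarrow> y \<in> Q \<Longrightarrow> real (T.gd (h x) (h y)) \<le> K * d x y + c"
    using qi_embeddingE[OF h] by blast
  obtain r0 where r0: "r0 \<ge> 0"
    and chain: "\<And>x. x \<in> Orb \<Longrightarrow> (x0, x) \<in> {(a, b). a \<in> Orb \<and> b \<in> Orb \<and> d a b \<le> r0}\<^sup>*"
    using Orb_chain by blast
  \<comment> \<open>Bounds the jumps of the chain of orbit points after mapping it to the
    tree.\<close>
  define L where "L = K * r0 + c"
  \<comment> \<open>Orbit points whose images are within \<open>L\<close> of two adjacent vertices
    have images at most \<open>2 * L + 1\<close> apart; the lower estimate for \<open>h\<close>
    turns this into the distance \<open>K * (2 * L + 1 + c)\<close> in \<open>Q\<close>.\<close>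
  define r where "r = max 1 (K * (2 * L + 1 + c))"
  have L: "L \<ge> 0" using K r0 c by (simp add: L_def)
  have OV: "h ` Orb \<subseteq> V" using hV Orb_sub by blast
  let ?R = "{(a, b). a \<in> h ` Orb \<and> b \<in> h ` Orb \<and> real (T.gd a b) \<le> L}"
  have chain0: "(h x0, h x) \<in> ?R\<^sup>*" if "x \<in> Orb" for x
    using chain[OF that]
  proof (induction rule: rtrancl_induct)
    case (step y z)
    then have yz: "y \<in> Orb" "z \<in> Orb" "d y z \<le> r0" by auto
    then have "K * d y z \<le> K * r0" using K by (intro mult_left_mono) auto
    then have "real (T.gd (h y) (h z)) \<le> L"
      using upper[of y z] yz Orb_sub by (force simp: L_def)
    with yz have "(h y, h z) \<in> ?R" by blast
    with step.IH show ?case by (rule rtrancl_into_rtrancl)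
  qed simp
  have "sym ?R" using OV T.gd_sym by (fastforce simp: sym_def)
  then have chain1: "(h x, h y) \<in> ?R\<^sup>*" if "x \<in> Orb" "y \<in> Orb" for x y
    using chain0[OF that(1)] chain0[OF that(2)] sym_rtrancl by (meson rtrancl_trans symD)
  \<comment> \<open>Rips edges join distinct points, so a jump from a point to itself adds no edge;
    hence an upper bound on the length of the walk instead of an exact value.\<close>
  have jump: "\<exists>m\<le>Suc n. (x, b) \<in> adj (redges r) ^^ m"
    if "(x, a) \<in> adj (redges r) ^^ n" "a \<in> Orb" "b \<in> Orb" "real (T.gd (h a) (h b)) \<le> 2 * L + 1" for x a b n
  proof (cases "a = b")
    case False
    have "d a b \<le> K * (real (T.gd (h a) (h b)) + c)"
      using lower that Orb_sub by blast
    also have "\<dots> \<le> K * (2 * L + 1 + c)"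
      using that K by (intro mult_left_mono) auto
    finally have "(a, b) \<in> adj (redges r)"
      using that False by (simp add: adj_def redges_iff r_def)
    with that(1) show ?thesis by (blast intro: relpow_Suc_I)
  qed (use that in \<open>auto intro: le_SucI\<close>)
  \<comment> \<open>The geodesic has \<open>m\<close> edges and
    \<open>m \<le> K * d x y + c\<close>. The additional 2 pays for stepping from \<open>x\<close>
    to the point near the first vertex and from the point near the last vertex to
    \<open>y\<close>.\<close>
  have walk: "\<exists>n. (x, y) \<in> adj (redges r) ^^ n \<and> real n \<le> K * d x y + (c + 2)"
    if xy: "x \<in> Orb" "y \<in> Orb" for x y
  proof -
    define m where "m = T.gd (h x) (h y)"
    have hxy: "h x \<in> V" "h y \<in> V" using xy OV by auto
    obtain f where f: "f 0 = h x" "f m = h y" "\<And>i. i < m \<Longrightarrow> {f i, f (Suc i)} \<in> E"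
      "\<And>i. i \<le> m \<Longrightarrow> f i \<in> T.interval (h x) (h y)"
      using T.geodesic[OF hxy] unfolding m_def by metis
    have fV: "f i \<in> V" if "i \<le> m" for i using f(4)[OF that] by (simp add: T.interval_def)
    have "\<exists>z\<in>Orb. real (T.gd (h z) (f i)) \<le> L" if "i \<le> m" for i
      using T.bottleneck[OF chain1[OF xy] OV _ _ f(4)[OF that] L] xy by blast
    then obtain z where z: "\<And>i. i \<le> m \<Longrightarrow> z i \<in> Orb \<and> real (T.gd (h (z i)) (f i)) \<le> L"
      by metis
    have "\<exists>n\<le>i + 1. (x, z i) \<in> adj (redges r) ^^ n" if "i \<le> m" for i
      using that
    proof (induction i)
      case 0
      have "real (T.gd (h x) (h (z 0))) \<le> 2 * L + 1"
        using z[of 0] f(1) L T.gd_sym[OF hxy(1), of "h (z 0)"] OV by auto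
      then show ?case
        using jump[of x x 0 "z 0"] xy z[of 0] by auto
    next
      case (Suc i)
      then obtain n where n: "n \<le> i + 1" "(x, z i) \<in> adj (redges r) ^^ n" by auto
      have V: "h (z i) \<in> V" "h (z (Suc i)) \<in> V" "f i \<in> V" "f (Suc i) \<in> V"
        using z[of i] z[of "Suc i"] Suc.prems OV fV by auto
      have "{f i, f (Suc i)} \<in> E" using f(3)[of i] Suc.prems by simp
      from T.gd_edge[OF this] have
        "T.gd (h (z i)) (h (z (Suc i))) \<le> T.gd (h (z i)) (f i) + (1 + T.gd (h (z (Suc i))) (f (Suc i)))"
        using T.gd_triangle[OF V(1) V(3) V(2)] T.gd_triangle[OF V(3) V(4) V(2)] T.gd_sym[OF V(2) V(4)]
        by linarith
      then have "real (T.gd (h (z i)) (h (z (Suc i)))) \<le> 2 * L + 1"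
        using z[of i] z[of "Suc i"] Suc.prems by linarith
      then obtain k where "k \<le> Suc n" "(x, z (Suc i)) \<in> adj (redges r) ^^ k"
        using jump[OF n(2)] z[of i] z[of "Suc i"] Suc.prems by auto
      with n(1) show ?case by (intro exI[of _ k]) auto
    qed
    then obtain n where n: "n \<le> m + 1" "(x, z m) \<in> adj (redges r) ^^ n" by blast
    have "real (T.gd (h (z m)) (h y)) \<le> 2 * L + 1"
      using z[of m] f(2) L by auto
    then obtain k where "k \<le> Suc n" "(x, y) \<in> adj (redges r) ^^ k"
      using jump[OF n(2)] z[of m] xy by auto
    moreover have "real m \<le> K * d x y + c"
      unfolding m_def using upper xy Orb_sub by blast
    ultimately show ?thesis using n(1) by (intro exI[of _ k]) auto
  qed
  have "r \<ge> 1" "c + 2 \<ge> 0" using c by (auto simp: r_def)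
  from that[OF this(1) K this(2) walk] show thesis .
qed

section \<open>Admissible Rips graphs and their trees\<close>

lemma supp_realization_action:
  "coord_supp (realization_action G \<phi> Orb g p) = {v \<in> Orb. \<phi> (inv\<^bsub>G\<^esub> g) v \<in> coord_supp p}"
  by (auto simp: coord_supp_def realization_action_def)

text \<open>Translated back by \<open>g\<close>, both choices belong to the support of
  \<open>p\<close>, so they coincide or are joined by an edge, and an edge spans at most
  \<open>r\<close> in \<open>Q\<close>.\<close>

lemma coarse_equivariant_some_vertex:
  assumes "connected_graph Orb (redges r)" "r > 0"
  shows "coarse_equivariant G (realization Orb (redges r)) (realization_action G \<phi> Orb) d \<phi> some_vertex"
  unfolding coarse_equivariant_def
proof (intro exI[of _ r] conjI ballI)
  fix p g assume p: "p \<in> realization Orb (redges r)" and g: "g \<in> carrier G"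
  interpret X: connected_graph Orb "redges r" by fact
  let ?u = "some_vertex p" and ?v = "some_vertex (realization_action G \<phi> Orb g p)"
  have u: "?u \<in> coord_supp p" "?u \<in> Orb" using X.some_vertex_in[OF p] X.some_vertex_V[OF p] by auto
  have "\<phi> g ?u \<in> coord_supp (realization_action G \<phi> Orb g p)"
    using u g act_Orb act_inv Orb_sub by (auto simp: supp_realization_action)
  then have "?v \<in> coord_supp (realization_action G \<phi> Orb g p)"
    unfolding some_vertex_def by (rule someI)
  then have v: "?v \<in> Orb" "\<phi> (inv\<^bsub>G\<^esub> g) ?v \<in> coord_supp p"
    by (auto simp: supp_realization_action)
  then have w: "\<phi> (inv\<^bsub>G\<^esub> g) ?v \<in> Orb" using act_Orb g by simp
  have "d (\<phi> (inv\<^bsub>G\<^esub> g) ?v) ?u \<le> r * real (X.gd (\<phi> (inv\<^bsub>G\<^esub> g) ?v) ?u)"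
    by (rule d_le_gd[OF assms(1) w u(2)])
  also have "\<dots> \<le> r * 1"
    using X.realizationD(4)[OF p v(2) u(1)] assms(2) by (intro mult_left_mono) auto
  finally have "d (\<phi> (inv\<^bsub>G\<^esub> g) ?v) ?u \<le> r" by simp
  then show "d ?v (\<phi> g ?u) \<le> r"
    using isom[OF g, of "\<phi> (inv\<^bsub>G\<^esub> g) ?v" ?u] inv_act[OF g, of ?v] v(1) w u(2) Orb_sub
    by (auto simp: subset_iff)
qed (use assms in simp)

lemma ex_admissible:
  assumes T: "tree V E" and h: "qi_embedding Q d V (\<lambda>u v. real (graph_dist V E u v)) h"
  shows "\<exists>r>0. admissible_rips_graph G \<phi> Q d x0 r"
proof -
  obtain r K c where r: "r \<ge> 1" and K: "K \<ge> 1" and c: "c \<ge> 0"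
    and walk: "\<And>x y. x \<in> Orb \<Longrightarrow> y \<in> Orb \<Longrightarrow>
      \<exists>n. (x, y) \<in> adj (redges r) ^^ n \<and> real n \<le> K * d x y + c"
    using Rips_walk[OF T h] by blast
  have conn: "graph_connected Orb (redges r)"
    unfolding graph_connected_def
    using x0_Orb walk walk_iff_relpow[OF redges_simple] by blast
  then have X: "connected_graph Orb (redges r)"
    using redges_simple by unfold_locales
  interpret X: connected_graph Orb "redges r" by (rule X)
  \<comment> \<open>The embedding is the inclusion of the orbit. \<open>K\<close> serves the lower
    estimate, by \<open>Rips_walk\<close>, and \<open>r\<close> the upper one, by
    \<open>d_le_gd\<close>; hence the maximum.\<close>
  have "qi_embedding Orb (\<lambda>x y. real (X.gd x y)) Q d id"
  proof (rule qi_embeddingI[where K = "max K r" and c = c])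
    fix x y assume xy: "x \<in> Orb" "y \<in> Orb"
    obtain n where n: "(x, y) \<in> adj (redges r) ^^ n" "real n \<le> K * d x y + c"
      using walk xy by blast
    have "real (X.gd x y) \<le> real n"
      using X.gd_le[OF xy(1) n(1)] by simp
    also note n(2)
    also have "K * d x y + c \<le> max K r * d x y + max K r * c"
    proof (rule add_mono)
      show "K * d x y \<le> max K r * d x y" by (intro mult_right_mono) auto
      show "c \<le> max K r * c" using K c mult_right_mono[of 1 "max K r" c] by linarith
    qed
    finally have "real (X.gd x y) \<le> (d x y + c) * max K r" by (simp add: algebra_simps)
    then have "real (X.gd x y) / max K r \<le> d x y + c"
      using K by (subst pos_divide_le_eq) auto
    then show "real (X.gd x y) / max K r - c \<le> d (id x) (id y)" by simp
    have "d x y \<le> r * real (X.gd x y)" by (rule d_le_gd[OF X xy])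
    also have "\<dots> \<le> max K r * real (X.gd x y)" by (intro mult_right_mono) auto
    finally show "d (id x) (id y) \<le> max K r * real (X.gd x y) + c" using c by simp
  qed (use K c Orb_sub in auto)
  from qi_embedding_comp[OF X.qi_some_vertex this]
  have "qi_embedding (realization Orb (redges r)) (realization_dist Orb (redges r)) Q d some_vertex"
    by simp
  then have "admissible_rips_graph G \<phi> Q d x0 r"
    unfolding admissible_rips_graph_def rips_space_def rips_dist_def
    using conn coarse_equivariant_some_vertex[OF X] r by auto
  with r show ?thesis by (intro exI[of _ r]) auto
qed

text \<open>The graph is sent to the tree by way of its realization and \<open>Q\<close>. One tree
  serves both claims, its valence being bounded when the orbit is locally finite.\<close>

lemma ex_tree_of_admissible:
  assumes T: "tree V E" and h: "qi_embedding Q d V (\<lambda>u v. real (graph_dist V E u v)) h"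
    and r: "r > 0" "admissible_rips_graph G \<phi> Q d x0 r"
  shows "\<exists>(V' :: nat set) E'. simplicial_tree V' E' \<and>
    quasi_isometric (rips_space G \<phi> d x0 r) (rips_dist G \<phi> d x0 r)
      (realization V' E') (realization_dist V' E') \<and>
    (locally_finite_orbit G \<phi> d x0 \<longrightarrow> bounded_valence V' E')"
proof -
  have X: "connected_graph Orb (redges r)"
    using r(2) redges_simple unfolding admissible_rips_graph_def by unfold_locales auto
  interpret X: connected_graph Orb "redges r" by (rule X)
  obtain F where "qi_embedding (realization Orb (redges r)) (realization_dist Orb (redges r)) Q d F"
    using r(2) unfolding admissible_rips_graph_def rips_space_def rips_dist_def by blast
  from ex_tree_of_qi_embedding[OF X T countable_Orb
      qi_embedding_comp[OF qi_embedding_comp[OF X.qi_vertex_point this] h]]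
  show ?thesis
    unfolding rips_space_def rips_dist_def
    using uniformly_locally_finite[OF X _ r(1)] by blast
qed

end

theorem theorem5p4:
  fixes G :: "('g, 'm) monoid_scheme"
    and \<phi> :: "'g \<Rightarrow> 'q \<Rightarrow> 'q"
    and Q :: "'q set"
    and d :: "'q \<Rightarrow> 'q \<Rightarrow> real"
  assumes "group G"
    and "finitely_generated G"
    and "quasitree TYPE('t) Q d"
    and "isometric_action G \<phi> Q d"
  shows "(\<forall>x0\<in>Q. \<exists>r>0. admissible_rips_graph G \<phi> Q d x0 r) \<and>
    (\<forall>x0\<in>Q. \<forall>r>0. admissible_rips_graph G \<phi> Q d x0 r \<longrightarrow>
      (\<exists>(V :: nat set) E. simplicial_tree V E \<and>
         quasi_isometric (rips_space G \<phi> d x0 r) (rips_dist G \<phi> d x0 r)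
           (realization V E) (realization_dist V E)) \<and>
      (locally_finite_orbit G \<phi> d x0 \<longrightarrow>
        (\<exists>(V :: nat set) E. simplicial_tree V E \<and> bounded_valence V E \<and>
           quasi_isometric (rips_space G \<phi> d x0 r) (rips_dist G \<phi> d x0 r)
             (realization V E) (realization_dist V E))))"
proof -
  obtain V :: "'t set" and E f where T: "tree V E"
    and f: "qi_embedding Q d (realization V E) (realization_dist V E) f"
    using assms(3) unfolding quasitree_def quasi_isometric_def quasi_isometry_def simplicial_tree_iff
    by blast
  interpret T: tree V E by (rule T)
  \<comment> \<open>Moving each image point to a vertex of its edge replaces the realization of the
    tree by its vertex set, where the cut vertex arguments apply.\<close>
  note h = qi_embedding_comp[OF f T.qi_some_vertex]
  have orb: "isometric_orbit G \<phi> Q d x0" if "x0 \<in> Q" for x0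
    using assms that unfolding isometric_orbit_def quasitree_def geodesic_metric_space_def by blast
  show ?thesis
    using isometric_orbit.ex_admissible[OF orb T h] isometric_orbit.ex_tree_of_admissible[OF orb T h]
    by meson
qed

end
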